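(* Let $\varphi\colon\Gamma\to\Gamma$ be a renormalization with associated $\Gamma$-odometer $(X_\varphi,\Gamma,\Phi_\varphi)$. Then the action has a well-defined type $\tau[X_\varphi,\Gamma,\Phi_\varphi]$ and typeset $\Xi[X_\varphi,\Gamma,\Phi_\varphi]$. Let $\varphi'\colon\Gamma'\to\Gamma'$ be a renormalization of a second group $\Gamma'$, and assume the odometers $(X_\varphi,\Gamma,\Phi_\varphi)$ and $(X_{\varphi'},\Gamma',\Phi_{\varphi'})$ are return equivalent. Then their types and typesets are equal: $\tau[X_\varphi,\Gamma,\Phi_\varphi]=\tau[X_{\varphi'},\Gamma',\Phi_{\varphi'}]$ and $\Xi[X_\varphi,\Gamma,\Phi_\varphi]=\Xi[X_{\varphi'},\Gamma',\Phi_{\varphi'}]$.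
   Context: Renormalizations. A renormalization of a finitely generated group $\Gamma$ is a proper self-embedding $\varphi\colon\Gamma\to\Gamma$ (an injective, non-surjective homomorphism) whose image has finite index. It defines the group chain $\mathcal{G}_\varphi$ with $\Gamma_0=\Gamma$, $\Gamma_{\ell+1}=\varphi(\Gamma_\ell)$; the associated odometer $(X_\varphi,\Gamma,\Phi_\varphi)$ is the odometer $(X_\infty,\Gamma,\Phi_\infty)$ of this chain, as defined next. Odometers and group chains. A Cantor action $(\mathfrak{X},\Gamma,\Phi)$ is an action of a group $\Gamma$ by homeomorphisms on a Cantor space $\mathfrak{X}$; write $g\cdot x=\Phi(g)(x)$. An odometer is a Cantor action which is minimal (all orbits dense) and equicontinuous. A group chain $\mathcal{G}=\{\Gamma=\Gamma_0\supset\Gamma_1\supset\cdots\}$ is a descending chain of finite index subgroups (not assumed normal). Put $X_\ell=\Gamma/\Gamma_\ell$, $X_\infty=\varprojlim\{X_{\ell+1}\to X_\ell\}$, with $\Phi_\infty$ the action of $\Gamma$ on $X_\infty$ induced by left multiplication. $\mathcal{G}$ is a group chain model for an odometer $(\mathfrak{X},\Gamma,\Phi)$ if there is a homeomorphism $\mathfrak{X}\to X_\infty$ conjugating $\Phi$ to $\Phi_\infty$ (as $\Gamma$-actions). Types and typesets. A Steinitz number is a formal product $\xi=\prod_{p}p^{\chi_\xi(p)}$ over all primes $p$, with $\chi_\xi(p)\in\{0,1,\ldots,\infty\}$; the least common multiple of a collection of positive integers is a Steinitz number, with exponent at $p$ the supremum of the exponents. $\xi,\xi'$ are asymptotically equivalent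 if $m\cdot\xi=m'\cdot\xi'$ for some integers $m,m'\ge1$; the equivalence class of $\xi$ is its type $\tau[\xi]$. The type of an odometer is $\tau[\mathfrak{X},\Gamma,\Phi]=\tau[\xi(\mathcal{G})]$, where $\xi(\mathcal{G})=\mathrm{lcm}\{[\Gamma:\Gamma_\ell]\mid\ell>0\}$ for a choice of group chain model $\mathcal{G}$. Let $C_\ell=\bigcap_{\delta\in\Gamma}\delta\Gamma_\ell\delta^{-1}$; for $\gamma\in\Gamma$ let $\xi(\gamma)=\mathrm{lcm}\{\#(\langle\gamma\rangle/(\langle\gamma\rangle\cap C_\ell))\mid\ell>0\}$ and $\tau[\gamma]=\tau[\xi(\gamma)]$. The typeset of the odometer is $\Xi[\mathfrak{X},\Gamma,\Phi]=\{\tau[\gamma]\mid\gamma\in\Gamma\}$, computed from a choice of group chain model. "Well-defined" means independent of the choice of group chain model. Return equivalence. A non-empty clopen set $U\subset\mathfrak{X}$ is adapted if for all $g\in\Gamma$, $g\cdot U\cap U\neq\emptyset$ implies $g\cdot U=U$; then $\Gamma_U=\{g\in\Gamma\mid g\cdot U\cap U\ne\emptyset\}$ is a finite index subgroup which acts on $U$; let $\mathcal{H}_U\subset\mathrm{Homeo}(U)$ be the image of $\Gamma_U$, acting on $U$ by $\Phi_U$. Actions $(\mathfrak{X}_1,\Gamma_1,\Phi_1)$, $(\mathfrak{X}_2,\Gamma_2,\Phi_2)$ are isomorphic if there are a homeomorphism $h\colon\mathfrak{X}_1\to\mathfrak{X}_2$ and a group isomorphism $\Theta\colon\Gamma_1\to\Gamma_2$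 with $\Phi_1(g)=h^{-1}\circ\Phi_2(\Theta(g))\circ h$ for all $g\in\Gamma_1$. Odometers are return equivalent if there are adapted sets $U\subset\mathfrak{X}$, $U'\subset\mathfrak{X}'$ such that $(U,\mathcal{H}_U,\Phi_U)$ and $(U',\mathcal{H}'_{U'},\Phi'_{U'})$ are isomorphic. *)

theory Defs
  imports
    "HOL-Analysis.Analysis"
    "HOL-Algebra.Left_Coset"
    "HOL-Algebra.Generated_Groups"
    "HOL-Algebra.Group_Action"
    "HOL-Computational_Algebra.Primes"
    "HOL-Library.Extended_Nat"
begin

section \<open>Steinitz numbers and types\<close>

text \<open>A Steinitz number is given by its exponents; the exponents at non-primes carry no
  information and are pinned to \<open>0\<close>, so that equality is equality of formal products.\<close>

typedef steinitz = "{e :: nat \<Rightarrow> enat. \<forall>p. \<not> prime p \<longrightarrow> e p = 0}"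
  morphisms exponent Steinitz
  by (rule exI[of _ "\<lambda>_. 0"]) simp

text \<open>Only meant for sets of positive integers.\<close>

definition steinitz_lcm :: "nat set \<Rightarrow> steinitz" where
  "steinitz_lcm N = Steinitz (\<lambda>p. if prime p then (SUP n\<in>N. enat (multiplicity p n)) else 0)"

definition steinitz_scale :: "nat \<Rightarrow> steinitz \<Rightarrow> steinitz" where
  "steinitz_scale m \<xi> =
     Steinitz (\<lambda>p. if prime p then enat (multiplicity p m) + exponent \<xi> p else 0)"

definition asymptotic_equiv :: "(steinitz \<times> steinitz) set" where
  "asymptotic_equiv =
     {(\<xi>, \<xi>'). \<exists>m m'. m \<ge> 1 \<and> m' \<ge> 1 \<and> steinitz_scale m \<xi> = steinitz_scale m' \<xi>'}"

definition type_of_steinitz :: "steinitz \<Rightarrow> steinitz set" where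
  "type_of_steinitz \<xi> = asymptotic_equiv `` {\<xi>}"


section \<open>Odometers\<close>

text \<open>Throughout, a topological space is a \<open>topology\<close> with its own carrier \<open>topspace\<close>, and an
  action of \<open>\<Gamma>\<close> on \<open>X\<close> is a \<open>group_action\<close> on \<open>topspace X\<close>; in particular the maps \<open>\<Phi> g\<close> are
  \<open>undefined\<close> outside \<open>topspace X\<close>.\<close>

definition cantor_space :: "'x topology \<Rightarrow> bool" where
  "cantor_space X \<longleftrightarrow>
     topspace X \<noteq> {} \<and> compact_space X \<and> metrizable_space X \<and>
     (\<forall>S. connectedin X S \<longrightarrow> (\<exists>a. S \<subseteq> {a})) \<and>
     (\<forall>x\<in>topspace X. \<not> openin X {x})"

definition cantor_action ::
    "('a, 'm) monoid_scheme \<Rightarrow> 'x topology \<Rightarrow> ('a \<Rightarrow> 'x \<Rightarrow> 'x) \<Rightarrow> bool" where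
  "cantor_action \<Gamma> X \<Phi> \<longleftrightarrow>
     cantor_space X \<and> group_action \<Gamma> (topspace X) \<Phi> \<and>
     (\<forall>g\<in>carrier \<Gamma>. homeomorphic_map X X (\<Phi> g))"

definition minimal_action ::
    "('a, 'm) monoid_scheme \<Rightarrow> 'x topology \<Rightarrow> ('a \<Rightarrow> 'x \<Rightarrow> 'x) \<Rightarrow> bool" where
  "minimal_action \<Gamma> X \<Phi> \<longleftrightarrow> (\<forall>x\<in>topspace X. X closure_of (orbit \<Gamma> \<Phi> x) = topspace X)"

text \<open>On a compact metrizable space the choice of the compatible metric is immaterial.\<close>

definition equicontinuous_action ::
    "('a, 'm) monoid_scheme \<Rightarrow> 'x topology \<Rightarrow> ('a \<Rightarrow> 'x \<Rightarrow> 'x) \<Rightarrow> bool" where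
  "equicontinuous_action \<Gamma> X \<Phi> \<longleftrightarrow>
     (\<exists>d. Metric_space (topspace X) d \<and> Metric_space.mtopology (topspace X) d = X \<and>
       (\<forall>\<epsilon>>0. \<exists>\<delta>>0. \<forall>g\<in>carrier \<Gamma>. \<forall>x\<in>topspace X. \<forall>y\<in>topspace X.
          d x y < \<delta> \<longrightarrow> d (\<Phi> g x) (\<Phi> g y) < \<epsilon>))"

definition odometer ::
    "('a, 'm) monoid_scheme \<Rightarrow> 'x topology \<Rightarrow> ('a \<Rightarrow> 'x \<Rightarrow> 'x) \<Rightarrow> bool" where
  "odometer \<Gamma> X \<Phi> \<longleftrightarrow>
     cantor_action \<Gamma> X \<Phi> \<and> minimal_action \<Gamma> X \<Phi> \<and> equicontinuous_action \<Gamma> X \<Phi>"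


section \<open>Group chains\<close>

definition group_chain :: "('a, 'm) monoid_scheme \<Rightarrow> (nat \<Rightarrow> 'a set) \<Rightarrow> bool" where
  "group_chain \<Gamma> G \<longleftrightarrow>
     group \<Gamma> \<and> G 0 = carrier \<Gamma> \<and>
     (\<forall>l. subgroup (G l) \<Gamma> \<and> finite (lcosets\<^bsub>\<Gamma>\<^esub> (G l)) \<and> G (Suc l) \<subseteq> G l)"

text \<open>The inverse limit of the discrete spaces \<open>\<Gamma>/\<Gamma>\<^sub>l\<close> of left cosets, along the maps
  \<open>g\<Gamma>\<^sub>l\<^sub>+\<^sub>1 \<mapsto> g\<Gamma>\<^sub>l\<close>.\<close>

definition chain_space ::
    "('a, 'm) monoid_scheme \<Rightarrow> (nat \<Rightarrow> 'a set) \<Rightarrow> (nat \<Rightarrow> 'a set) topology" where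
  "chain_space \<Gamma> G =
     subtopology (product_topology (\<lambda>l. discrete_topology (lcosets\<^bsub>\<Gamma>\<^esub> (G l))) UNIV)
       {x. \<forall>l. \<exists>g\<in>carrier \<Gamma>. x (Suc l) = g <#\<^bsub>\<Gamma>\<^esub> G (Suc l) \<and> x l = g <#\<^bsub>\<Gamma>\<^esub> G l}"

definition chain_action ::
    "('a, 'm) monoid_scheme \<Rightarrow> (nat \<Rightarrow> 'a set) \<Rightarrow> 'a \<Rightarrow> (nat \<Rightarrow> 'a set) \<Rightarrow> (nat \<Rightarrow> 'a set)" where
  "chain_action \<Gamma> G g = (\<lambda>x\<in>topspace (chain_space \<Gamma> G). \<lambda>l. g <#\<^bsub>\<Gamma>\<^esub> x l)"

definition group_chain_model ::
    "('a, 'm) monoid_scheme \<Rightarrow> 'x topology \<Rightarrow> ('a \<Rightarrow> 'x \<Rightarrow> 'x) \<Rightarrow> (nat \<Rightarrow> 'a set) \<Rightarrow> bool" where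
  "group_chain_model \<Gamma> X \<Phi> G \<longleftrightarrow>
     group_chain \<Gamma> G \<and>
     (\<exists>h. homeomorphic_map X (chain_space \<Gamma> G) h \<and>
       (\<forall>g\<in>carrier \<Gamma>. \<forall>x\<in>topspace X. h (\<Phi> g x) = chain_action \<Gamma> G g (h x)))"


section \<open>Type and typeset\<close>

definition chain_type :: "('a, 'm) monoid_scheme \<Rightarrow> (nat \<Rightarrow> 'a set) \<Rightarrow> steinitz set" where
  "chain_type \<Gamma> G =
     type_of_steinitz (steinitz_lcm {card (lcosets\<^bsub>\<Gamma>\<^esub> (G l)) | l. l > 0})"

definition normal_core :: "('a, 'm) monoid_scheme \<Rightarrow> 'a set \<Rightarrow> 'a set" where
  "normal_core \<Gamma> H = (\<Inter>\<delta>\<in>carrier \<Gamma>. \<delta> <#\<^bsub>\<Gamma>\<^esub> H #>\<^bsub>\<Gamma>\<^esub> inv\<^bsub>\<Gamma>\<^esub> \<delta>)"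

definition element_type ::
    "('a, 'm) monoid_scheme \<Rightarrow> (nat \<Rightarrow> 'a set) \<Rightarrow> 'a \<Rightarrow> steinitz set" where
  "element_type \<Gamma> G \<gamma> =
     type_of_steinitz (steinitz_lcm
       {order (\<Gamma>\<lparr>carrier := generate \<Gamma> {\<gamma>}\<rparr> Mod (generate \<Gamma> {\<gamma>} \<inter> normal_core \<Gamma> (G l))) | l. l > 0})"

definition chain_typeset :: "('a, 'm) monoid_scheme \<Rightarrow> (nat \<Rightarrow> 'a set) \<Rightarrow> steinitz set set" where
  "chain_typeset \<Gamma> G = {element_type \<Gamma> G \<gamma> | \<gamma>. \<gamma> \<in> carrier \<Gamma>}"

definition odometer_type ::
    "('a, 'm) monoid_scheme \<Rightarrow> 'x topology \<Rightarrow> ('a \<Rightarrow> 'x \<Rightarrow> 'x) \<Rightarrow> steinitz set" where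
  "odometer_type \<Gamma> X \<Phi> = chain_type \<Gamma> (SOME G. group_chain_model \<Gamma> X \<Phi> G)"

definition odometer_typeset ::
    "('a, 'm) monoid_scheme \<Rightarrow> 'x topology \<Rightarrow> ('a \<Rightarrow> 'x \<Rightarrow> 'x) \<Rightarrow> steinitz set set" where
  "odometer_typeset \<Gamma> X \<Phi> = chain_typeset \<Gamma> (SOME G. group_chain_model \<Gamma> X \<Phi> G)"

definition well_defined_type ::
    "('a, 'm) monoid_scheme \<Rightarrow> 'x topology \<Rightarrow> ('a \<Rightarrow> 'x \<Rightarrow> 'x) \<Rightarrow> bool" where
  "well_defined_type \<Gamma> X \<Phi> \<longleftrightarrow>
     (\<exists>G. group_chain_model \<Gamma> X \<Phi> G) \<and>
     (\<forall>G G'. group_chain_model \<Gamma> X \<Phi> G \<longrightarrow> group_chain_model \<Gamma> X \<Phi> G' \<longrightarrow>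
        chain_type \<Gamma> G = chain_type \<Gamma> G')"

definition well_defined_typeset ::
    "('a, 'm) monoid_scheme \<Rightarrow> 'x topology \<Rightarrow> ('a \<Rightarrow> 'x \<Rightarrow> 'x) \<Rightarrow> bool" where
  "well_defined_typeset \<Gamma> X \<Phi> \<longleftrightarrow>
     (\<exists>G. group_chain_model \<Gamma> X \<Phi> G) \<and>
     (\<forall>G G'. group_chain_model \<Gamma> X \<Phi> G \<longrightarrow> group_chain_model \<Gamma> X \<Phi> G' \<longrightarrow>
        chain_typeset \<Gamma> G = chain_typeset \<Gamma> G')"


section \<open>Return equivalence\<close>

definition adapted_set ::
    "('a, 'm) monoid_scheme \<Rightarrow> 'x topology \<Rightarrow> ('a \<Rightarrow> 'x \<Rightarrow> 'x) \<Rightarrow> 'x set \<Rightarrow> bool" where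
  "adapted_set \<Gamma> X \<Phi> U \<longleftrightarrow>
     U \<noteq> {} \<and> openin X U \<and> closedin X U \<and>
     (\<forall>g\<in>carrier \<Gamma>. \<Phi> g ` U \<inter> U \<noteq> {} \<longrightarrow> \<Phi> g ` U = U)"

definition return_subgroup ::
    "('a, 'm) monoid_scheme \<Rightarrow> ('a \<Rightarrow> 'x \<Rightarrow> 'x) \<Rightarrow> 'x set \<Rightarrow> 'a set" where
  "return_subgroup \<Gamma> \<Phi> U = {g \<in> carrier \<Gamma>. \<Phi> g ` U \<inter> U \<noteq> {}}"

definition homeo_group :: "'x topology \<Rightarrow> ('x \<Rightarrow> 'x) monoid" where
  "homeo_group X =
     (BijGroup (topspace X))\<lparr>carrier := {f \<in> Bij (topspace X). homeomorphic_map X X f}\<rparr>"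

text \<open>The group \<open>\<H>\<^sub>U\<close>, as a subgroup of \<open>Homeo(U)\<close>. Its elements are maps of \<open>U\<close>, so its
  action \<open>\<Phi>\<^sub>U\<close> on \<open>U\<close> is evaluation, that is \<open>\<lambda>f. f\<close>.\<close>

definition holonomy_group ::
    "('a, 'm) monoid_scheme \<Rightarrow> 'x topology \<Rightarrow> ('a \<Rightarrow> 'x \<Rightarrow> 'x) \<Rightarrow> 'x set \<Rightarrow> ('x \<Rightarrow> 'x) monoid" where
  "holonomy_group \<Gamma> X \<Phi> U =
     (homeo_group (subtopology X U))
       \<lparr>carrier := (\<lambda>g. restrict (\<Phi> g) U) ` return_subgroup \<Gamma> \<Phi> U\<rparr>"

definition isomorphic_actions ::
    "('a, 'm) monoid_scheme \<Rightarrow> 'x topology \<Rightarrow> ('a \<Rightarrow> 'x \<Rightarrow> 'x) \<Rightarrow>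
     ('b, 'n) monoid_scheme \<Rightarrow> 'y topology \<Rightarrow> ('b \<Rightarrow> 'y \<Rightarrow> 'y) \<Rightarrow> bool" where
  "isomorphic_actions \<Gamma>\<^sub>1 X\<^sub>1 \<Phi>\<^sub>1 \<Gamma>\<^sub>2 X\<^sub>2 \<Phi>\<^sub>2 \<longleftrightarrow>
     (\<exists>h k \<Theta>. homeomorphic_maps X\<^sub>1 X\<^sub>2 h k \<and> \<Theta> \<in> iso \<Gamma>\<^sub>1 \<Gamma>\<^sub>2 \<and>
       (\<forall>g\<in>carrier \<Gamma>\<^sub>1. \<forall>x\<in>topspace X\<^sub>1. \<Phi>\<^sub>1 g x = k (\<Phi>\<^sub>2 (\<Theta> g) (h x))))"

definition return_equivalent ::
    "('a, 'm) monoid_scheme \<Rightarrow> 'x topology \<Rightarrow> ('a \<Rightarrow> 'x \<Rightarrow> 'x) \<Rightarrow>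
     ('b, 'n) monoid_scheme \<Rightarrow> 'y topology \<Rightarrow> ('b \<Rightarrow> 'y \<Rightarrow> 'y) \<Rightarrow> bool" where
  "return_equivalent \<Gamma> X \<Phi> \<Gamma>' X' \<Phi>' \<longleftrightarrow>
     (\<exists>U U'. adapted_set \<Gamma> X \<Phi> U \<and> adapted_set \<Gamma>' X' \<Phi>' U' \<and>
       isomorphic_actions
         (holonomy_group \<Gamma> X \<Phi> U) (subtopology X U) (\<lambda>f. f)
         (holonomy_group \<Gamma>' X' \<Phi>' U') (subtopology X' U') (\<lambda>f. f))"


section \<open>Renormalizations\<close>

definition finitely_generated_group :: "('a, 'm) monoid_scheme \<Rightarrow> bool" where
  "finitely_generated_group \<Gamma> \<longleftrightarrow>
     group \<Gamma> \<and> (\<exists>S. finite S \<and> S \<subseteq> carrier \<Gamma> \<and> generate \<Gamma> S = carrier \<Gamma>)"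

definition renormalization :: "('a, 'm) monoid_scheme \<Rightarrow> ('a \<Rightarrow> 'a) \<Rightarrow> bool" where
  "renormalization \<Gamma> \<phi> \<longleftrightarrow>
     finitely_generated_group \<Gamma> \<and> \<phi> \<in> hom \<Gamma> \<Gamma> \<and> inj_on \<phi> (carrier \<Gamma>) \<and>
     \<phi> ` carrier \<Gamma> \<noteq> carrier \<Gamma> \<and> finite (lcosets\<^bsub>\<Gamma>\<^esub> (\<phi> ` carrier \<Gamma>))"

primrec renorm_chain :: "('a, 'm) monoid_scheme \<Rightarrow> ('a \<Rightarrow> 'a) \<Rightarrow> nat \<Rightarrow> 'a set" where
  "renorm_chain \<Gamma> \<phi> 0 = carrier \<Gamma>"
| "renorm_chain \<Gamma> \<phi> (Suc l) = \<phi> ` renorm_chain \<Gamma> \<phi> l"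

definition renorm_space ::
    "('a, 'm) monoid_scheme \<Rightarrow> ('a \<Rightarrow> 'a) \<Rightarrow> (nat \<Rightarrow> 'a set) topology" where
  "renorm_space \<Gamma> \<phi> = chain_space \<Gamma> (renorm_chain \<Gamma> \<phi>)"

definition renorm_action ::
    "('a, 'm) monoid_scheme \<Rightarrow> ('a \<Rightarrow> 'a) \<Rightarrow> 'a \<Rightarrow> (nat \<Rightarrow> 'a set) \<Rightarrow> (nat \<Rightarrow> 'a set)" where
  "renorm_action \<Gamma> \<phi> = chain_action \<Gamma> (renorm_chain \<Gamma> \<phi>)"

end

theory Submission
  imports Defs
begin

text \<open>
  Two chains are compared through a relation \<open>R\<close> between finite index subgroups of the two groups
  that respects, in both directions, the stabilizers of the level sets around a point of each
  odometer. For two models of one odometer \<open>R\<close> is the identity; for a return equivalence it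
  relates \<open>g\<close> and \<open>g'\<close> when they induce corresponding maps of the adapted sets. Counting cosets
  along \<open>R\<close> shows that the indices of the chains divide each other up to the fixed indices of the
  domain and range of \<open>R\<close>, which gives equality of types.

  For the typesets one must know that an element acting trivially on a small clopen set, down to a
  deep level, acts trivially on the whole space down to a prescribed level. For a renormalization
  this says that \<open>\<phi>\<close> maps the normal core of some \<open>\<Gamma>\<^sub>m\<close> into that of \<open>\<Gamma>\<^sub>l\<close>. Since \<open>\<Gamma>\<close> is finitely
  generated, two iterates \<open>\<phi>\<^sup>i\<close> and \<open>\<phi>\<^sup>j\<close> induce the same action on \<open>\<Gamma>/\<Gamma>\<^sub>l\<close>, which makes \<open>\<phi>\<^sup>j\<^sup>-\<^sup>i\<close>
  act on deep cores as the identity modulo the core of \<open>\<Gamma>\<^sub>l\<close>. The claim follows because an element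
  of a deep core is the image under \<open>\<phi>\<^sup>j\<^sup>-\<^sup>i\<^sup>-\<^sup>1\<close> of an element of a core that is still deep.
\<close>

section \<open>Asymptotic equivalence of least common multiples\<close>

lemma exponent_Steinitz:
  "exponent (Steinitz (\<lambda>p. if prime p then f p else 0)) p = (if prime p then f p else 0)"
  by (subst Steinitz_inverse) auto

lemma exponent_nonprime: "\<not> prime p \<Longrightarrow> exponent \<xi> p = 0"
  using exponent[of \<xi>] by auto

lemma steinitz_eqI:
  assumes "\<And>p. prime p \<Longrightarrow> exponent \<xi> p = exponent \<xi>' p"
  shows "\<xi> = \<xi>'"
proof -
  have "exponent \<xi> p = exponent \<xi>' p" for p
    by (cases "prime p") (simp_all add: assms exponent_nonprime)
  then show ?thesis
    by (metis exponent_inject ext)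
qed

lemma exponent_scale:
  "prime p \<Longrightarrow> exponent (steinitz_scale m \<xi>) p = enat (multiplicity p m) + exponent \<xi> p"
  by (simp add: steinitz_scale_def exponent_Steinitz)

lemma exponent_lcm:
  "prime p \<Longrightarrow> exponent (steinitz_lcm N) p = (SUP n\<in>N. enat (multiplicity p n))"
  by (simp add: steinitz_lcm_def exponent_Steinitz)

lemma steinitz_scale_scale:
  assumes "m \<ge> 1" "n \<ge> 1"
  shows "steinitz_scale m (steinitz_scale n \<xi>) = steinitz_scale (m * n) \<xi>"
  using assms
  by (intro steinitz_eqI)
     (simp add: exponent_scale prime_elem_multiplicity_mult_distrib add.assoc flip: plus_enat_simps)

lemma equiv_asymptotic_equiv: "equiv UNIV asymptotic_equiv"
proof (rule equivI)
  show "refl_on UNIV asymptotic_equiv"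
    by (auto simp: refl_on_def asymptotic_equiv_def)
  show "sym asymptotic_equiv"
    unfolding sym_def asymptotic_equiv_def by (auto, metis)
  show "trans asymptotic_equiv"
  proof (rule transI)
    fix a b c assume "(a, b) \<in> asymptotic_equiv" "(b, c) \<in> asymptotic_equiv"
    then obtain m m' n n' where mn: "m \<ge> 1" "m' \<ge> 1" "n \<ge> 1" "n' \<ge> 1"
      and eq: "steinitz_scale m a = steinitz_scale m' b" "steinitz_scale n b = steinitz_scale n' c"
      by (auto simp: asymptotic_equiv_def)
    have "steinitz_scale (n * m) a = steinitz_scale (m' * n) b"
      using mn eq(1) by (metis mult.commute steinitz_scale_scale)
    also have "\<dots> = steinitz_scale (m' * n') c"
      using mn eq(2) by (metis steinitz_scale_scale)
    finally have "steinitz_scale (n * m) a = steinitz_scale (m' * n') c" .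
    moreover have "n * m \<ge> 1" "m' * n' \<ge> 1"
      using mn by simp_all
    ultimately show "(a, c) \<in> asymptotic_equiv"
      unfolding asymptotic_equiv_def by blast
  qed
qed auto

lemma type_of_steinitz_eqI:
  assumes "steinitz_scale m \<xi> = steinitz_scale m' \<xi>'" "m \<ge> 1" "m' \<ge> 1"
  shows "type_of_steinitz \<xi> = type_of_steinitz \<xi>'"
  unfolding type_of_steinitz_def
  by (rule equiv_class_eq[OF equiv_asymptotic_equiv]) (use assms in \<open>auto simp: asymptotic_equiv_def\<close>)

text \<open>Adding a finite \<open>k\<close> can be undone: \<open>enat k + u \<le> enat c\<close>
  means \<open>k \<le> c\<close> together with \<open>u \<le> enat (c - k)\<close>, and the second
  condition passes to suprema. Non-emptiness of \<open>N\<close> is what yields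
  \<open>k \<le> c\<close>, the empty supremum being 0.\<close>

lemma enat_add_SUP_le:
  assumes "\<And>n. n \<in> N \<Longrightarrow> enat k + f n \<le> b" and "N \<noteq> {}"
  shows "enat k + (SUP n\<in>N. f n) \<le> b"
proof (cases b)
  case (enat c)
  have *: "enat k + u \<le> enat c \<longleftrightarrow> k \<le> c \<and> u \<le> enat (c - k)" for u
    by (cases u) auto
  have "(SUP n\<in>N. f n) \<le> enat (c - k)" "k \<le> c"
    using assms by (auto simp: enat * intro!: SUP_least)
  then show ?thesis
    by (simp add: enat *)
qed simp

text \<open>Divisibility is read off prime by prime, and exponents of products add. Positivity
  guards against the convention \<open>multiplicity p 0 = 0\<close>, under which dividing 0 would
  bound no exponent.\<close>

lemma exponent_scale_lcm_le:
  assumes "prime p" and "k \<ge> 1" "k' \<ge> 1" "N \<noteq> {}"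
    and "\<And>n. n \<in> N \<Longrightarrow> n \<ge> 1" "\<And>n. n \<in> N' \<Longrightarrow> n \<ge> 1"
    and "\<And>n. n \<in> N \<Longrightarrow> \<exists>n'\<in>N'. k * n dvd k' * n'"
  shows "exponent (steinitz_scale k (steinitz_lcm N)) p
    \<le> exponent (steinitz_scale k' (steinitz_lcm N')) p"
proof -
  have "\<exists>n'\<in>N'. enat (multiplicity p k) + enat (multiplicity p n)
      \<le> enat (multiplicity p k') + enat (multiplicity p n')" if n: "n \<in> N" for n
  proof -
    obtain n' where n': "n' \<in> N'" "k * n dvd k' * n'"
      using assms(7)[OF n] by blast
    have pos: "n \<ge> 1" "n' \<ge> 1"
      using assms n n' by auto
    have "multiplicity p (k * n) \<le> multiplicity p (k' * n')"
      using n'(2) pos assms(3) by (intro dvd_imp_multiplicity_le) auto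
    then have "multiplicity p k + multiplicity p n \<le> multiplicity p k' + multiplicity p n'"
      using assms pos by (simp add: prime_elem_multiplicity_mult_distrib)
    then show ?thesis
      using n'(1) by auto
  qed
  then have "enat (multiplicity p k) + enat (multiplicity p n)
      \<le> enat (multiplicity p k') + (SUP n'\<in>N'. enat (multiplicity p n'))" if "n \<in> N" for n
    using that by (meson SUP_upper add_left_mono order_trans)
  then show ?thesis
    using assms by (simp add: exponent_scale exponent_lcm enat_add_SUP_le)
qed

text \<open>The two divisibility conditions bound the exponents of the rescaled least common
  multiples from both sides. All equalities of types below, for indices as well as for orders of
  elements, come from this criterion.\<close>

lemma type_of_lcm_eqI:
  assumes "k \<ge> 1" "k' \<ge> 1" "N \<noteq> {}" "N' \<noteq> {}"
    and "\<And>n. n \<in> N \<Longrightarrow> n \<ge> 1" "\<And>n. n \<in> N' \<Longrightarrow> n \<ge> 1"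
    and "\<And>n. n \<in> N \<Longrightarrow> \<exists>n'\<in>N'. k * n dvd k' * n'"
    and "\<And>n'. n' \<in> N' \<Longrightarrow> \<exists>n\<in>N. k' * n' dvd k * n"
  shows "type_of_steinitz (steinitz_lcm N) = type_of_steinitz (steinitz_lcm N')"
proof (rule type_of_steinitz_eqI)
  show "steinitz_scale k (steinitz_lcm N) = steinitz_scale k' (steinitz_lcm N')"
    using assms by (intro steinitz_eqI antisym exponent_scale_lcm_le) auto
qed (use assms in auto)

section \<open>Cosets, indices and normal cores\<close>

no_notation (ASCII) subset_mset (infix \<open><#\<close> 50) \<comment> \<open>clashes with left cosets\<close>

text \<open>The hypothesis says that \<open>f\<close> and \<open>f'\<close> have the same fibres
  along \<open>R\<close>, so sending \<open>f a\<close> to \<open>f' b\<close> for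
  \<open>(a, b) \<in> R\<close> is a well-defined bijection of the two images. \<open>R\<close> may
  be multivalued in both directions, as happens for actions that are not faithful.\<close>

lemma card_image_eq_via_relation:
  assumes "\<And>a b c d. (a, b) \<in> R \<Longrightarrow> (c, d) \<in> R \<Longrightarrow> f a = f c \<longleftrightarrow> f' b = f' d"
  shows "card (f ` fst ` R) = card (f' ` snd ` R)"
proof -
  let ?F = "\<lambda>r. f (fst r)" and ?F' = "\<lambda>r. f' (snd r)"
  have eq: "?F r = ?F s \<longleftrightarrow> ?F' r = ?F' s" if "r \<in> R" "s \<in> R" for r s
    using assms[of "fst r" "snd r" "fst s" "snd s"] that by simp
  define h where "h y = ?F' (inv_into R ?F y)" for y
  have h: "h (?F r) = ?F' r" if "r \<in> R" for r
    unfolding h_def using that eq[of "inv_into R ?F (?F r)" r]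
    by (metis (no_types, lifting) f_inv_into_f image_eqI inv_into_into)
  have "bij_betw h (?F ` R) (?F' ` R)"
  proof (rule bij_betw_imageI)
    show "inj_on h (?F ` R)"
    proof (rule inj_onI)
      fix y z assume "y \<in> ?F ` R" "z \<in> ?F ` R" "h y = h z"
      moreover from this obtain r s where "r \<in> R" "s \<in> R" "y = ?F r" "z = ?F s"
        by blast
      ultimately show "y = z"
        by (simp only: h eq)
    qed
    show "h ` ?F ` R = ?F' ` R"
      using h by (simp add: image_image)
  qed
  then show ?thesis
    by (simp add: bij_betw_same_card image_image)
qed

lemma card_image_eq:
  assumes "\<And>a b. a \<in> A \<Longrightarrow> b \<in> A \<Longrightarrow> f a = f b \<longleftrightarrow> g a = g b"
  shows "card (f ` A) = card (g ` A)"
  using card_image_eq_via_relation[of "(\<lambda>a. (a, a)) ` A" f g] assms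
  by (auto simp: image_image)

text \<open>Pigeonhole principle, applied below to the powers of one element and to the iterates of
  \<phi>, both acting on a finite set of cosets.\<close>

lemma finite_range_collision:
  assumes "finite A" "\<And>i::nat. f i \<in> A"
  obtains i j where "i < j" "f i = f j"
proof -
  have "\<not> inj f"
    using assms by (meson finite_subset image_subsetI range_inj_infinite)
  then show thesis
    using that unfolding inj_def by (metis linorder_neqE_nat)
qed

context group
begin

section \<open>Left cosets and normal cores\<close>

lemma l_coset_eq_iff:
  assumes "subgroup S G" "g \<in> carrier G" "k \<in> carrier G"
  shows "g <# S = k <# S \<longleftrightarrow> inv g \<otimes> k \<in> S"
proof
  assume "g <# S = k <# S"
  then have "k \<in> g <# S"
    using lcos_self assms by simp
  then show "inv g \<otimes> k \<in> S"
    using subgroup.lcos_module_imp[OF assms(1) is_group] assms by blast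
next
  assume "inv g \<otimes> k \<in> S"
  then have "k \<in> g <# S"
    using subgroup.lcos_module_rev[OF assms(1) is_group] assms by blast
  then show "g <# S = k <# S"
    using l_repr_independence assms by blast
qed

lemma l_coset_cancel:
  assumes "g \<in> carrier G" "c \<subseteq> carrier G" "d \<subseteq> carrier G"
  shows "g <# c = g <# d \<longleftrightarrow> c = d"
  using assms by (metis inv_closed l_inv lcos_m_assoc lcos_mult_one)

lemma lcosetsI: "g \<in> carrier G \<Longrightarrow> g <# S \<in> lcosets S"
  by (auto simp: LCOSETS_def)

lemma lcosets_image: "lcosets S = (\<lambda>g. g <# S) ` carrier G"
  by (auto simp: LCOSETS_def)

lemma l_coset_lcosets:
  "S \<subseteq> carrier G \<Longrightarrow> g \<in> carrier G \<Longrightarrow> c \<in> lcosets S \<Longrightarrow> g <# c \<in> lcosets S"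
  by (auto simp: LCOSETS_def lcos_m_assoc)

text \<open>Moving \<open>a\<close> across shows that the stabilizer of the coset
  \<open>a <# S\<close> is the conjugate of \<open>S\<close> by \<open>a\<close>. This passes
  between conjugates, by which cores are defined, and the permutation action on cosets.\<close>

lemma conj_mem_iff_l_coset_fixed:
  assumes "subgroup S G" "a \<in> carrier G" "g \<in> carrier G"
  shows "g <# (a <# S) = a <# S \<longleftrightarrow> inv a \<otimes> g \<otimes> a \<in> S"
proof -
  have "g <# (a <# S) = a <# S \<longleftrightarrow> a <# S = (g \<otimes> a) <# S"
    using assms by (auto simp: lcos_m_assoc subgroup.subset)
  also have "\<dots> \<longleftrightarrow> inv a \<otimes> g \<otimes> a \<in> S"
    using assms by (simp add: l_coset_eq_iff m_assoc)
  finally show ?thesis .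
qed

lemma mem_normal_core_iff:
  assumes "subgroup S G"
  shows "z \<in> normal_core G S \<longleftrightarrow> z \<in> carrier G \<and> (\<forall>d\<in>carrier G. inv d \<otimes> z \<otimes> d \<in> S)"
proof -
  have sub: "S \<subseteq> carrier G"
    using assms by (rule subgroup.subset)
  have *: "z \<in> d <# S #> inv d \<longleftrightarrow> z \<in> carrier G \<and> inv d \<otimes> z \<otimes> d \<in> S" if d: "d \<in> carrier G" for d
  proof
    assume "z \<in> d <# S #> inv d"
    then obtain s where "s \<in> S" "z = d \<otimes> s \<otimes> inv d"
      by (auto simp: l_coset_def r_coset_def)
    then show "z \<in> carrier G \<and> inv d \<otimes> z \<otimes> d \<in> S"
      using d sub by (auto simp: m_assoc subset_iff) (simp flip: m_assoc)
  next
    assume z: "z \<in> carrier G \<and> inv d \<otimes> z \<otimes> d \<in> S"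
    have "d \<otimes> (inv d \<otimes> z \<otimes> d) \<otimes> inv d = z"
      using z d by (simp add: m_assoc) (simp flip: m_assoc)
    then show "z \<in> d <# S #> inv d"
      using z unfolding l_coset_def r_coset_def by force
  qed
  then show ?thesis
    unfolding normal_core_def by auto
qed

text \<open>Lying in every conjugate of \<open>S\<close> amounts to fixing every coset, so the core
  is the kernel of the permutation action on \<open>lcosets S\<close>.\<close>

lemma mem_normal_core_iff_fixes:
  assumes "subgroup S G"
  shows "z \<in> normal_core G S \<longleftrightarrow> z \<in> carrier G \<and> (\<forall>c\<in>lcosets S. z <# c = c)"
  by (simp add: mem_normal_core_iff[OF assms] lcosets_image conj_mem_iff_l_coset_fixed[OF assms]
      cong: conj_cong)

lemma subgroup_normal_core:
  assumes "subgroup S G"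
  shows "subgroup (normal_core G S) G"
proof -
  have sub: "c \<subseteq> carrier G" if "c \<in> lcosets S" for c
    using that assms by (meson is_group subgroup.lcosets_carrier)
  show ?thesis
  proof
    fix x assume x: "x \<in> normal_core G S"
    show "inv x \<in> normal_core G S"
      unfolding mem_normal_core_iff_fixes[OF assms]
    proof (intro conjI ballI)
      fix c assume c: "c \<in> lcosets S"
      have "inv x <# c = inv x <# (x <# c)"
        using x c by (simp add: mem_normal_core_iff_fixes[OF assms])
      also have "\<dots> = c"
        using x sub[OF c] by (simp add: mem_normal_core_iff_fixes[OF assms] lcos_m_assoc lcos_mult_one)
      finally show "inv x <# c = c" .
    qed (use x in \<open>simp add: mem_normal_core_iff_fixes[OF assms]\<close>)
  qed (auto simp: mem_normal_core_iff_fixes[OF assms] lcos_mult_one sub simp flip: lcos_m_assoc)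
qed

lemma normal_core_subset:
  assumes "subgroup S G"
  shows "normal_core G S \<subseteq> S"
proof
  fix z assume "z \<in> normal_core G S"
  then have "z \<in> carrier G" "inv \<one> \<otimes> z \<otimes> \<one> \<in> S"
    unfolding mem_normal_core_iff[OF assms] by blast+
  then show "z \<in> S" by simp
qed

lemma normal_core_conj:
  assumes "subgroup S G" "z \<in> normal_core G S" "d \<in> carrier G"
  shows "inv d \<otimes> z \<otimes> d \<in> normal_core G S"
proof -
  have z: "z \<in> carrier G"
    using assms mem_normal_core_iff by blast
  have "inv e \<otimes> (inv d \<otimes> z \<otimes> d) \<otimes> e = inv (d \<otimes> e) \<otimes> z \<otimes> (d \<otimes> e)" if "e \<in> carrier G" for e
    using that z assms(3) by (simp add: m_assoc inv_mult_group)
  then show ?thesis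
    using assms z by (simp add: mem_normal_core_iff)
qed

lemma normal_core_conj_iff:
  assumes "subgroup S G" "z \<in> carrier G" "d \<in> carrier G"
  shows "inv d \<otimes> z \<otimes> d \<in> normal_core G S \<longleftrightarrow> z \<in> normal_core G S"
proof
  assume *: "inv d \<otimes> z \<otimes> d \<in> normal_core G S"
  have "inv (inv d) \<otimes> (inv d \<otimes> z \<otimes> d) \<otimes> inv d = z"
    using assms by (simp add: m_assoc) (simp flip: m_assoc)
  then show "z \<in> normal_core G S"
    using normal_core_conj[OF assms(1) *] assms(3) by (metis inv_closed)
qed (use assms normal_core_conj in blast)

text \<open>A coset of \<open>S\<close> in \<open>H\<close> is reached by choosing a representative
  of the coset of \<open>B\<close> containing it and then a coset of \<open>S\<close> inside
  \<open>B\<close>. A bijection, rather than an equation of cardinalities, serves both the product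
  formula for indices and the transfer of finiteness.\<close>

lemma bij_betw_lcosets_tower:
  assumes "subgroup H G" "subgroup B G" "subgroup S G" "B \<subseteq> H" "S \<subseteq> B"
  shows "\<exists>f. bij_betw f ((\<lambda>g. g <# B) ` H \<times> (\<lambda>g. g <# S) ` B) ((\<lambda>g. g <# S) ` H)"
proof -
  \<comment> \<open>\<open>r\<close> chooses a representative in \<open>H\<close>, so that its
    products with elements of \<open>B\<close> stay in \<open>H\<close>.\<close>
  define r where "r c = (SOME g. g \<in> H \<and> c = g <# B)" for c
  have r: "r c \<in> H" "r c <# B = c" if "c \<in> (\<lambda>g. g <# B) ` H" for c
  proof -
    have "\<exists>g. g \<in> H \<and> c = g <# B" using that by blast
    from someI_ex[OF this] show "r c \<in> H" "r c <# B = c"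
      by (auto simp: r_def)
  qed
  have H: "h \<in> carrier G" if "h \<in> H" for h
    using that assms(1) subgroup.subset by blast
  have B: "b \<in> carrier G" if "b \<in> B" for b
    using that assms H by blast
  have S: "S \<subseteq> carrier G"
    using assms(3) by (rule subgroup.subset)
  have "bij_betw (\<lambda>(c, d). r c <# d) ((\<lambda>g. g <# B) ` H \<times> (\<lambda>g. g <# S) ` B) ((\<lambda>g. g <# S) ` H)"
    unfolding bij_betw_def
  proof
    show "inj_on (\<lambda>(c, d). r c <# d) ((\<lambda>g. g <# B) ` H \<times> (\<lambda>g. g <# S) ` B)"
    proof (rule inj_onI, clarify)
      fix g b g' b' assume g: "g \<in> H" "g' \<in> H" and b: "b \<in> B" "b' \<in> B"
        and eq: "r (g <# B) <# (b <# S) = r (g' <# B) <# (b' <# S)"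
      let ?r = "r (g <# B)" and ?r' = "r (g' <# B)"
      have rr: "?r \<in> carrier G" "?r' \<in> carrier G" "?r <# B = g <# B" "?r' <# B = g' <# B"
        using r g H by blast+
      have bb: "b \<in> carrier G" "b' \<in> carrier G"
        using b B by auto
      have "inv (?r \<otimes> b) \<otimes> (?r' \<otimes> b') \<in> S"
        using eq rr bb S assms(3) by (simp add: lcos_m_assoc l_coset_eq_iff)
      \<comment> \<open>Multiplying the element of \<open>S\<close> by \<open>b\<close> and
        \<open>inv b'\<close> leaves the quotient of the two representatives, now known to lie in
        \<open>B\<close>.\<close>
      then have "b \<otimes> (inv (?r \<otimes> b) \<otimes> (?r' \<otimes> b')) \<otimes> inv b' \<in> B"
        using assms b by (meson subgroup.m_closed subgroup.m_inv_closed subsetD)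
      also have "b \<otimes> (inv (?r \<otimes> b) \<otimes> (?r' \<otimes> b')) \<otimes> inv b' = inv ?r \<otimes> ?r'"
        using rr bb by (simp add: inv_mult_group m_assoc) (simp flip: m_assoc)
      finally have *: "?r <# B = ?r' <# B"
        using rr assms(2) l_coset_eq_iff by blast
      then have "g <# B = g' <# B"
        using rr by simp
      moreover from this have "b <# S = b' <# S"
        using eq rr bb S by (simp add: l_coset_cancel l_coset_subset_G)
      ultimately show "g <# B = g' <# B \<and> b <# S = b' <# S" ..
    qed
    show "(\<lambda>(c, d). r c <# d) ` ((\<lambda>g. g <# B) ` H \<times> (\<lambda>g. g <# S) ` B) = (\<lambda>g. g <# S) ` H"
    proof (intro equalityI subsetI)
      fix x assume "x \<in> (\<lambda>(c, d). r c <# d) ` ((\<lambda>g. g <# B) ` H \<times> (\<lambda>g. g <# S) ` B)"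
      then obtain g b where g: "g \<in> H" "b \<in> B" "x = r (g <# B) <# (b <# S)"
        by auto
      then have "x = (r (g <# B) \<otimes> b) <# S" "r (g <# B) \<otimes> b \<in> H"
        using r(1)[of "g <# B"] assms H B S by (auto simp: lcos_m_assoc intro: subgroup.m_closed)
      then show "x \<in> (\<lambda>g. g <# S) ` H" by blast
    next
      fix x assume "x \<in> (\<lambda>g. g <# S) ` H"
      then obtain g where g: "g \<in> H" "x = g <# S" by blast
      let ?r = "r (g <# B)"
      have rr: "?r \<in> carrier G" "?r <# B = g <# B"
        using r g H by blast+
      then have "inv ?r \<otimes> g \<in> B"
        using g H assms(2) l_coset_eq_iff by blast
      moreover have "x = ?r <# ((inv ?r \<otimes> g) <# S)"
        using g rr H S by (simp add: lcos_m_assoc flip: m_assoc)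
      ultimately show "x \<in> (\<lambda>(c, d). r c <# d) ` ((\<lambda>g. g <# B) ` H \<times> (\<lambda>g. g <# S) ` B)"
        using g by force
    qed
  qed
  then show ?thesis by blast
qed

lemma card_lcosets_tower:
  assumes "subgroup H G" "subgroup B G" "subgroup S G" "B \<subseteq> H" "S \<subseteq> B"
  shows "card ((\<lambda>g. g <# S) ` H) = card ((\<lambda>g. g <# B) ` H) * card ((\<lambda>g. g <# S) ` B)"
  using bij_betw_lcosets_tower[OF assms] by (metis bij_betw_same_card card_cartesian_product)

lemma finite_lcosets_tower:
  assumes "subgroup H G" "subgroup B G" "subgroup S G" "B \<subseteq> H" "S \<subseteq> B"
    and "finite ((\<lambda>g. g <# B) ` H)" "finite ((\<lambda>g. g <# S) ` B)"
  shows "finite ((\<lambda>g. g <# S) ` H)"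
  using bij_betw_lcosets_tower[OF assms(1-5)] assms(6,7) bij_betw_finite by blast

text \<open>Two powers of \<open>g\<close> induce the same map on the finite set
  \<open>lcosets S\<close>; their quotient is a power acting trivially, that is, an element of the
  core.\<close>

lemma ex_power_in_normal_core:
  assumes "subgroup S G" "finite (lcosets S)" "g \<in> carrier G"
  shows "\<exists>n\<ge>1. g [^] (n::nat) \<in> normal_core G S"
proof -
  have S: "S \<subseteq> carrier G"
    using assms(1) by (rule subgroup.subset)
  let ?f = "\<lambda>i::nat. \<lambda>c\<in>lcosets S. g [^] i <# c"
  have "finite (lcosets S \<rightarrow>\<^sub>E lcosets S)"
    using assms(2) by (simp add: finite_PiE)
  moreover have "?f i \<in> lcosets S \<rightarrow>\<^sub>E lcosets S" for i
    using S assms(3) l_coset_lcosets by auto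
  ultimately obtain i j where ij: "i < j" "?f i = ?f j"
    using finite_range_collision[of "lcosets S \<rightarrow>\<^sub>E lcosets S" ?f] by blast
  have "g [^] (j - i) <# c = c" if c: "c \<in> lcosets S" for c
  proof -
    have cc: "c \<subseteq> carrier G"
      using c assms(1) by (meson is_group subgroup.lcosets_carrier)
    have "g [^] i <# (g [^] (j - i) <# c) = g [^] j <# c"
      using ij(1) cc assms(3) by (simp add: lcos_m_assoc nat_pow_mult)
    also have "\<dots> = g [^] i <# c"
      using fun_cong[OF ij(2), of c] c by simp
    finally show ?thesis
      using cc assms(3) by (simp add: l_coset_cancel l_coset_subset_G)
  qed
  then have "g [^] (j - i) \<in> normal_core G S"
    using assms by (simp add: mem_normal_core_iff_fixes)
  then show ?thesis
    using ij(1) by (intro exI[of _ "j - i"]) auto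
qed

text \<open>The group \<open>generate G {g}\<close> consists of the integer powers of
  \<open>g\<close>, and the exponents of those in \<open>K\<close> are the multiples of one number
  \<open>d0\<close>; cosets of the intersection thus correspond to residues modulo
  \<open>d0\<close>. This turns the orders in the definition of typesets into divisibility.\<close>

lemma order_cyclic_Mod:
  assumes g: "g \<in> carrier G" and K: "subgroup K G" and ex: "\<exists>n\<ge>1. g [^] (n::nat) \<in> K"
  defines "d \<equiv> order (G\<lparr>carrier := generate G {g}\<rparr> Mod (generate G {g} \<inter> K))"
  shows "d \<ge> 1" and "g [^] (n::nat) \<in> K \<longleftrightarrow> d dvd n"
proof -
  define d0 where "d0 = (LEAST n. n \<ge> 1 \<and> g [^] (n::nat) \<in> K)"
  have d0: "d0 \<ge> 1" "g [^] d0 \<in> K"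
    using LeastI_ex[of "\<lambda>n. n \<ge> 1 \<and> g [^] (n::nat) \<in> K"] ex by (auto simp: d0_def)
  have least: "g [^] n \<in> K \<Longrightarrow> n < d0 \<Longrightarrow> n = 0" for n :: nat
    using not_less_Least[of n "\<lambda>n. n \<ge> 1 \<and> g [^] (n::nat) \<in> K"] by (auto simp: d0_def)
  have pow_d0: "g [^] (int d0 * q) \<in> K" for q
  proof -
    have "(g [^] int d0) [^] q \<in> K"
      using d0(2) K by (simp add: int_pow_int subgroup_int_pow_closed)
    then show ?thesis
      using g by (simp add: int_pow_pow)
  qed
  have iff: "g [^] k \<in> K \<longleftrightarrow> int d0 dvd k" for k :: int
  proof
    assume k: "g [^] k \<in> K"
    have "g [^] (k mod int d0) = g [^] (k + int d0 * (- (k div int d0)))"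
      by (simp add: minus_mult_div_eq_mod [symmetric])
    also have "\<dots> = g [^] k \<otimes> g [^] (int d0 * (- (k div int d0)))"
      using g by (simp only: int_pow_mult)
    also have "\<dots> \<in> K"
      using k pow_d0 K by (metis subgroup.m_closed)
    finally have "g [^] nat (k mod int d0) \<in> K"
      using d0(1) by (simp add: int_pow_int [symmetric])
    moreover have "nat (k mod int d0) < d0"
      using d0(1) by (simp add: nat_less_iff)
    ultimately have "nat (k mod int d0) = 0"
      by (rule least)
    moreover have "k mod int d0 \<ge> 0"
      using d0(1) by simp
    ultimately show "int d0 dvd k"
      by (simp add: dvd_eq_mod_eq_0)
  qed (use pow_d0 in auto)
  let ?C = "generate G {g}"
  let ?N = "?C \<inter> K"
  have C: "subgroup ?C G"
    using g by (simp add: generate_is_subgroup)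
  have N: "subgroup ?N G"
    using C K by (rule subgroups_Inter_pair)
  have pow_C: "g [^] k \<in> ?C" for k :: int
    using generate_pow[OF g] by blast
  have coset: "?N #> g [^] k = ?N #> g [^] l \<longleftrightarrow> int d0 dvd k - l" for k l :: int
  proof -
    have "?N #> g [^] k = ?N #> g [^] l \<longleftrightarrow> g [^] k \<otimes> inv (g [^] l) \<in> ?N"
    proof
      assume "?N #> g [^] k = ?N #> g [^] l"
      then have "g [^] k \<in> ?N #> g [^] l"
        using rcos_self[OF _ N] g by (metis int_pow_closed)
      then show "g [^] k \<otimes> inv (g [^] l) \<in> ?N"
        using subgroup.rcos_module_imp[OF N is_group] g by simp
    next
      assume "g [^] k \<otimes> inv (g [^] l) \<in> ?N"
      then have "g [^] k \<in> ?N #> g [^] l"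
        using subgroup.rcos_module_rev[OF N is_group] g by simp
      then show "?N #> g [^] k = ?N #> g [^] l"
        using repr_independence N g by (metis int_pow_closed)
    qed
    also have "\<dots> \<longleftrightarrow> g [^] (k - l) \<in> K"
      using g pow_C[of "k - l"] by (simp add: int_pow_diff)
    finally show ?thesis by (simp add: iff)
  qed
  have "(\<lambda>x. M #> x) ` ?C = (\<lambda>k::int. M #> g [^] k) ` UNIV" for M
    using generate_pow[OF g] by auto
  then have "carrier (G\<lparr>carrier := ?C\<rparr> Mod ?N) = (\<lambda>k::int. ?N #> g [^] k) ` UNIV"
    by (simp add: carrier_FactGroup r_coset_def)
  then have "d = card ((\<lambda>k::int. ?N #> g [^] k) ` UNIV)"
    by (simp add: d_def order_def)
  also have "\<dots> = card ((\<lambda>k::int. k mod int d0) ` UNIV)"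
    by (rule card_image_eq) (simp only: coset mod_eq_dvd_iff)
  also have "range (\<lambda>k::int. k mod int d0) = {0..<int d0}"
  proof (intro equalityI subsetI)
    fix x assume "x \<in> {0..<int d0}"
    then have "x = x mod int d0" by simp
    then show "x \<in> range (\<lambda>k. k mod int d0)" by blast
  qed (use d0(1) in auto)
  finally have "d = d0" by simp
  then show "d \<ge> 1" "g [^] n \<in> K \<longleftrightarrow> d dvd n"
    using d0(1) iff[of "int n"] by (simp_all add: int_pow_int)
qed

end

section \<open>The odometer of a group chain\<close>

locale coset_chain = group \<Gamma> for \<Gamma> :: "('a, 'm) monoid_scheme" (structure) +
  fixes G :: "nat \<Rightarrow> 'a set"
  assumes chain: "group_chain \<Gamma> G"
begin

section \<open>Points of the inverse limit and their coordinates\<close>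

abbreviation points :: "(nat \<Rightarrow> 'a set) set" where
  "points \<equiv> topspace (chain_space \<Gamma> G)"

text \<open>One coordinate determines all earlier ones (\<open>points_agree_le\<close>), so
  prescribing coordinate \<open>l\<close> alone prescribes an initial segment.\<close>

definition cylinder :: "(nat \<Rightarrow> 'a set) \<Rightarrow> nat \<Rightarrow> (nat \<Rightarrow> 'a set) set" where
  "cylinder x l = {y \<in> points. y l = x l}"

lemma subgroup_G: "subgroup (G l) \<Gamma>"
  and G_0: "G 0 = carrier \<Gamma>"
  and finite_lcosets_G: "finite (lcosets (G l))"
  and G_Suc_subset: "G (Suc l) \<subseteq> G l"
  using chain by (simp_all add: group_chain_def)

lemma G_subset: "G l \<subseteq> carrier \<Gamma>"
  using subgroup_G by (rule subgroup.subset)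

lemma G_antimono: "i \<le> j \<Longrightarrow> G j \<subseteq> G i"
  using lift_Suc_antimono_le[of G, OF G_Suc_subset] .

text \<open>Compatibility at \<open>l\<close> presents coordinate \<open>l\<close> as a coset, which
  places the sequence in the product.\<close>

lemma points_eq:
  "points = {x. \<forall>l. \<exists>g\<in>carrier \<Gamma>. x (Suc l) = g <# G (Suc l) \<and> x l = g <# G l}"
proof -
  have "x l \<in> lcosets (G l)"
    if x: "\<forall>l. \<exists>g\<in>carrier \<Gamma>. x (Suc l) = g <# G (Suc l) \<and> x l = g <# G l" for x l
  proof -
    obtain g where "g \<in> carrier \<Gamma>" "x l = g <# G l"
      using spec[OF x, of l] by blast
    then show ?thesis by (simp only: lcosetsI)
  qed
  then have "{x. \<forall>l. \<exists>g\<in>carrier \<Gamma>. x (Suc l) = g <# G (Suc l) \<and> x l = g <# G l}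
      \<subseteq> PiE UNIV (\<lambda>l. lcosets (G l))"
    by blast
  then show ?thesis
    by (simp add: chain_space_def Int_absorb1)
qed

lemma point_common_rep:
  assumes "x \<in> points"
  obtains a where "a \<in> carrier \<Gamma>" "x (Suc l) = a <# G (Suc l)" "x l = a <# G l"
  using assms by (auto simp: points_eq dest: spec[of _ l])

lemma point_rep:
  assumes "x \<in> points"
  obtains a where "a \<in> carrier \<Gamma>" "x l = a <# G l"
  using assms by (rule point_common_rep)

lemma point_lcosets: "x \<in> points \<Longrightarrow> x l \<in> lcosets (G l)"
  by (metis lcosetsI point_rep)

lemma point_subset: "x \<in> points \<Longrightarrow> x l \<subseteq> carrier \<Gamma>"
  using point_lcosets subgroup.lcosets_carrier[OF subgroup_G is_group] by blast

lemma l_coset_G_antimono: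
  assumes "a \<in> carrier \<Gamma>" "b \<in> carrier \<Gamma>" "a <# G j = b <# G j" "i \<le> j"
  shows "a <# G i = b <# G i"
  using assms G_antimono[of i j] by (auto simp: l_coset_eq_iff[OF subgroup_G])

text \<open>Downward induction from \<open>l\<close>: a representative shared by coordinates
  \<open>n\<close> and \<open>Suc n\<close> defines the same coset as \<open>a\<close> at
  \<open>Suc n\<close>, hence also for the larger subgroup \<open>G n\<close>.\<close>

lemma point_rep_le:
  assumes "x \<in> points" "a \<in> carrier \<Gamma>" "x l = a <# G l" "i \<le> l"
  shows "x i = a <# G i"
  using assms(4)
proof (induction rule: inc_induct)
  case base
  show ?case by (rule assms(3))
next
  case (step n)
  obtain g where g: "g \<in> carrier \<Gamma>" "x (Suc n) = g <# G (Suc n)" "x n = g <# G n"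
    using assms(1) by (rule point_common_rep)
  then show ?case
    using l_coset_G_antimono[OF g(1) assms(2), of "Suc n" n] step.IH g by simp
qed

lemma points_agree_le:
  assumes "x \<in> points" "y \<in> points" "x l = y l" "i \<le> l"
  shows "x i = y i"
  using assms by (metis point_rep point_rep_le)

lemma base_orbit_in_points: "a \<in> carrier \<Gamma> \<Longrightarrow> (\<lambda>l. a <# G l) \<in> points"
  unfolding points_eq by blast

section \<open>The translation action\<close>

lemma translate_in_points:
  assumes "g \<in> carrier \<Gamma>" "x \<in> points"
  shows "(\<lambda>l. g <# x l) \<in> points"
  unfolding points_eq
proof safe
  fix l
  obtain a where a: "a \<in> carrier \<Gamma>" "x (Suc l) = a <# G (Suc l)" "x l = a <# G l"
    using assms(2) by (rule point_common_rep)
  then show "\<exists>b\<in>carrier \<Gamma>. g <# x (Suc l) = b <# G (Suc l) \<and> g <# x l = b <# G l"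
    using assms(1) G_subset by (intro bexI[of _ "g \<otimes> a"]) (auto simp: lcos_m_assoc)
qed

lemma chain_action_eq: "x \<in> points \<Longrightarrow> chain_action \<Gamma> G g x = (\<lambda>l. g <# x l)"
  by (simp add: chain_action_def)

lemma chain_action_in_points:
  "g \<in> carrier \<Gamma> \<Longrightarrow> x \<in> points \<Longrightarrow> chain_action \<Gamma> G g x \<in> points"
  by (simp add: chain_action_eq translate_in_points)

lemma chain_action_mult:
  assumes "g \<in> carrier \<Gamma>" "h \<in> carrier \<Gamma>" "x \<in> points"
  shows "chain_action \<Gamma> G g (chain_action \<Gamma> G h x) = chain_action \<Gamma> G (g \<otimes> h) x"
  using assms point_subset
  by (simp add: chain_action_eq translate_in_points lcos_m_assoc)

lemma chain_action_one: "x \<in> points \<Longrightarrow> chain_action \<Gamma> G \<one> x = x"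
  using point_subset by (simp add: chain_action_eq lcos_mult_one)

lemma chain_action_inv:
  assumes "g \<in> carrier \<Gamma>" "x \<in> points"
  shows "chain_action \<Gamma> G g (chain_action \<Gamma> G (inv g) x) = x"
    and "chain_action \<Gamma> G (inv g) (chain_action \<Gamma> G g x) = x"
  using assms by (simp_all add: chain_action_mult chain_action_one)

lemma cylinder_refl: "x \<in> points \<Longrightarrow> x \<in> cylinder x l"
  by (simp add: cylinder_def)

section \<open>Cylinders as a base of the topology, and compactness\<close>

abbreviation level_product :: "(nat \<Rightarrow> 'a set) topology" where
  "level_product \<equiv> product_topology (\<lambda>l. discrete_topology (lcosets (G l))) UNIV"

lemma chain_space_eq_subtopology: "chain_space \<Gamma> G = subtopology level_product points"
  unfolding chain_space_def topspace_subtopology by (rule subtopology_restrict [symmetric])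

lemma openin_chain_space_trace:
  "openin (chain_space \<Gamma> G) U \<longleftrightarrow> (\<exists>T. openin level_product T \<and> U = T \<inter> points)"
  using openin_subtopology[of level_product points U]
  by (simp only: chain_space_eq_subtopology [symmetric])

lemma points_subset: "points \<subseteq> topspace level_product"
  unfolding chain_space_def topspace_subtopology by (rule Int_lower1)

lemma openin_product_level: "openin level_product {y \<in> topspace level_product. y l = x l}"
proof -
  have "openin level_product {y \<in> topspace level_product. y l \<in> {x l} \<inter> lcosets (G l)}"
    by (rule openin_continuous_map_preimage[OF continuous_map_product_projection]) auto
  also have "{y \<in> topspace level_product. y l \<in> {x l} \<inter> lcosets (G l)} =
      {y \<in> topspace level_product. y l = x l}"
    by (auto simp: PiE_def)
  finally show ?thesis .
qed

text \<open>A basic open set of the product restricts finitely many coordinates. If \<open>l\<close>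
  bounds their indices, agreement with \<open>x\<close> at \<open>l\<close> settles all of
  them.\<close>

lemma cylinder_subset_open:
  assumes U: "openin (chain_space \<Gamma> G) U" and x: "x \<in> U"
  shows "\<exists>l. cylinder x l \<subseteq> U"
proof -
  obtain T where T: "openin level_product T" "U = T \<inter> points"
    using U unfolding openin_chain_space_trace by blast
  have "x \<in> T" and xp: "x \<in> points"
    using x T by blast+
  obtain V where "finite {i \<in> UNIV. V i \<noteq> topspace (discrete_topology (lcosets (G i)))} \<and>
      (\<forall>i\<in>UNIV. openin (discrete_topology (lcosets (G i))) (V i)) \<and>
      x \<in> PiE UNIV V \<and> PiE UNIV V \<subseteq> T"
    using bspec[OF iffD1[OF openin_product_topology_alt T(1)] \<open>x \<in> T\<close>] ..
  then have V: "finite {i. V i \<noteq> lcosets (G i)}" "x \<in> PiE UNIV V" "PiE UNIV V \<subseteq> T"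
    by simp_all
  obtain l where l: "\<And>i. V i \<noteq> lcosets (G i) \<Longrightarrow> i \<le> l"
    using V(1)[unfolded finite_nat_set_iff_bounded_le] by auto
  have "y \<in> U" if "y \<in> cylinder x l" for y
  proof -
    have y: "y \<in> points" "y l = x l"
      using that by (auto simp: cylinder_def)
    have "y i \<in> V i" for i
    proof (cases "V i = lcosets (G i)")
      case False
      then have "y i = x i"
        using points_agree_le[OF y(1) xp y(2)] l by blast
      then show ?thesis using V(2) by auto
    qed (use y point_lcosets in auto)
    then show ?thesis
      using V(3) T(2) y(1) by (auto simp: PiE_iff)
  qed
  then show ?thesis by blast
qed

lemma openin_chain_space_iff:
  "openin (chain_space \<Gamma> G) U \<longleftrightarrow> U \<subseteq> points \<and> (\<forall>x\<in>U. \<exists>l. cylinder x l \<subseteq> U)"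
proof (intro iffI conjI)
  show "U \<subseteq> points" if "openin (chain_space \<Gamma> G) U"
    using that by (rule openin_subset)
  show "\<forall>x\<in>U. \<exists>l. cylinder x l \<subseteq> U" if "openin (chain_space \<Gamma> G) U"
    using that cylinder_subset_open by blast
  assume U: "U \<subseteq> points \<and> (\<forall>x\<in>U. \<exists>l. cylinder x l \<subseteq> U)"
  have "openin (chain_space \<Gamma> G) (cylinder x l)" for x l
  proof -
    have "cylinder x l = {y \<in> topspace level_product. y l = x l} \<inter> points"
      using points_subset unfolding cylinder_def by blast
    then show ?thesis
      unfolding openin_chain_space_trace using openin_product_level by blast
  qed
  moreover have "x \<in> cylinder x l" if "x \<in> U" for x l
    using U that by (intro cylinder_refl) blast
  ultimately show "openin (chain_space \<Gamma> G) U"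
    unfolding openin_subopen[of _ U] using U by metis
qed

lemma openin_cylinder: "openin (chain_space \<Gamma> G) (cylinder x l)"
  unfolding openin_chain_space_iff by (fastforce simp: cylinder_def)

lemma closedin_cylinder: "closedin (chain_space \<Gamma> G) (cylinder x l)"
  unfolding closedin_def openin_chain_space_iff by (fastforce simp: cylinder_def)

lemma compact_chain_space: "compact_space (chain_space \<Gamma> G)"
proof -
  have "openin level_product (topspace level_product - points)"
  proof (subst openin_subopen, rule ballI)
    fix x assume "x \<in> topspace level_product - points"
    then have x: "x \<in> topspace level_product" "x \<notin> points" by blast+
    \<comment> \<open>Incompatibility at \<open>l\<close> involves only the coordinates
      \<open>l\<close> and \<open>Suc l\<close>, so it persists on the open set \<open>?T\<close>
      that fixes these two.\<close>
    obtain l where l: "\<not> (\<exists>g\<in>carrier \<Gamma>. x (Suc l) = g <# G (Suc l) \<and> x l = g <# G l)"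
      using x(2) unfolding points_eq by blast
    let ?T = "{y \<in> topspace level_product. y l = x l} \<inter>
      {y \<in> topspace level_product. y (Suc l) = x (Suc l)}"
    have "y \<notin> points" if "y \<in> ?T" for y
    proof
      assume "y \<in> points"
      then obtain g where "g \<in> carrier \<Gamma>" "y (Suc l) = g <# G (Suc l)" "y l = g <# G l"
        by (rule point_common_rep)
      then show False
        using l that by auto
    qed
    then have "openin level_product ?T \<and> x \<in> ?T \<and> ?T \<subseteq> topspace level_product - points"
      using x openin_Int[OF openin_product_level openin_product_level, of l x "Suc l" x] by blast
    then show "\<exists>T. openin level_product T \<and> x \<in> T \<and> T \<subseteq> topspace level_product - points"
      by (rule exI [of _ ?T])
  qed
  then have "closedin level_product points"
    using points_subset by (simp only: closedin_def simp_thms)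
  moreover have "compact_space level_product"
    using finite_lcosets_G by (simp add: compact_space_product_topology compact_space_discrete_topology)
  ultimately have "compactin level_product points"
    using closedin_compact_space by blast
  then have "compact_space (subtopology level_product points)"
    by (rule compact_space_subtopology)
  then show ?thesis
    by (simp only: chain_space_eq_subtopology [symmetric])
qed

section \<open>An invariant ultrametric for the topology\<close>

definition cdist :: "(nat \<Rightarrow> 'a set) \<Rightarrow> (nat \<Rightarrow> 'a set) \<Rightarrow> real" where
  "cdist x y = (if x = y then 0 else 1 / (1 + real (LEAST l. x l \<noteq> y l)))"

text \<open>If \<open>m\<close> is the first level of disagreement, the distance is
  \<open>1 / (1 + m)\<close>, which is below \<open>1 / (1 + l)\<close> exactly when
  \<open>l < m\<close>. As agreement at \<open>l\<close> forces agreement before it, this is the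
  single condition \<open>x l = y l\<close>: open balls of these radii are cylinders.\<close>

lemma cdist_less_iff:
  assumes "x \<in> points" "y \<in> points"
  shows "cdist x y < 1 / (1 + real l) \<longleftrightarrow> x l = y l"
proof (cases "x = y")
  case False
  define m where "m = (LEAST l. x l \<noteq> y l)"
  have "\<exists>l. x l \<noteq> y l" using False by blast
  then have m: "x m \<noteq> y m"
    unfolding m_def by (rule LeastI_ex)
  have "x l = y l \<longleftrightarrow> l < m"
  proof
    show "l < m" if "x l = y l"
      using points_agree_le[OF assms that] m by (meson linorder_not_less)
    show "x l = y l" if "l < m"
      using not_less_Least[of l "\<lambda>l. x l \<noteq> y l"] that by (auto simp: m_def)
  qed
  then show ?thesis
    using False by (simp add: cdist_def m_def [symmetric] divide_simps)
qed (simp add: cdist_def)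

lemma cdist_ultrametric:
  assumes "x \<in> points" "y \<in> points" "z \<in> points"
  shows "cdist x z \<le> max (cdist x y) (cdist y z)"
proof (cases "x = z")
  case False
  define m where "m = (LEAST l. x l \<noteq> z l)"
  have "\<exists>l. x l \<noteq> z l" using False by blast
  then have "x m \<noteq> z m"
    unfolding m_def by (rule LeastI_ex)
  then have "x m \<noteq> y m \<or> y m \<noteq> z m" by auto
  then have "\<not> cdist x y < 1 / (1 + real m) \<or> \<not> cdist y z < 1 / (1 + real m)"
    using assms by (simp add: cdist_less_iff)
  then show ?thesis
    using False by (auto simp: cdist_def[of x z] m_def [symmetric] max_def)
qed (simp add: cdist_def le_max_iff_disj)

lemma Metric_space_cdist: "Metric_space points cdist"
proof
  show nonneg: "0 \<le> cdist x y" for x y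
    by (simp add: cdist_def)
  show "cdist x y = cdist y x" for x y
    by (simp add: cdist_def eq_commute)
  show "cdist x y = 0 \<longleftrightarrow> x = y" for x y
    by (auto simp: cdist_def)
  show "cdist x z \<le> cdist x y + cdist y z" if "x \<in> points" "y \<in> points" "z \<in> points" for x y z
    using cdist_ultrametric[OF that] nonneg[of x y] nonneg[of y z] by linarith
qed

lemma mtopology_cdist: "Metric_space.mtopology points cdist = chain_space \<Gamma> G"
proof -
  interpret Metric_space points cdist
    by (rule Metric_space_cdist)
  have ball: "mball x (1 / (1 + real l)) = cylinder x l" if "x \<in> points" for x l
    using that by (auto simp: cylinder_def cdist_less_iff)
  have small: "\<exists>l. 1 / (1 + real l) < r" if "r > 0" for r
    using nat_approx_posE[OF that] by (metis of_nat_Suc)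
  have "(\<exists>r>0. mball x r \<subseteq> U) \<longleftrightarrow> (\<exists>l. cylinder x l \<subseteq> U)" if x: "x \<in> points" for x U
  proof
    assume "\<exists>r>0. mball x r \<subseteq> U"
    then obtain r l where "mball x r \<subseteq> U" "1 / (1 + real l) < r"
      using small by blast
    then have "mball x (1 / (1 + real l)) \<subseteq> U"
      using mball_subset_concentric[of "1 / (1 + real l)" r x] by force
    then show "\<exists>l. cylinder x l \<subseteq> U"
      using ball x by blast
  next
    assume "\<exists>l. cylinder x l \<subseteq> U"
    then obtain l where "mball x (1 / (1 + real l)) \<subseteq> U"
      using ball x by blast
    then show "\<exists>r>0. mball x r \<subseteq> U"
      by (intro exI[of _ "1 / (1 + real l)"]) simp
  qed
  then show ?thesis
    unfolding topology_eq openin_mtopology openin_chain_space_iff by blast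
qed

lemma translate_level_eq_iff:
  assumes "g \<in> carrier \<Gamma>" "x \<in> points" "y \<in> points"
  shows "g <# x l = g <# y l \<longleftrightarrow> x l = y l"
  using assms by (simp add: l_coset_cancel point_subset)

text \<open>Left translation cancels in every coordinate and so preserves the first level of
  disagreement. Being isometries, the translations are equicontinuous with \<delta> equal to
  \<epsilon>.\<close>

lemma cdist_translate:
  assumes "g \<in> carrier \<Gamma>" "x \<in> points" "y \<in> points"
  shows "cdist (chain_action \<Gamma> G g x) (chain_action \<Gamma> G g y) = cdist x y"
  using assms by (simp add: chain_action_eq cdist_def fun_eq_iff translate_level_eq_iff)

lemma continuous_map_chain_action:
  assumes "g \<in> carrier \<Gamma>"
  shows "continuous_map (chain_space \<Gamma> G) (chain_space \<Gamma> G) (chain_action \<Gamma> G g)"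
  unfolding continuous_map openin_chain_space_iff
proof safe
  fix x assume x: "x \<in> points"
  show "chain_action \<Gamma> G g x \<in> points"
    using assms x by (rule chain_action_in_points)
  fix U assume U: "\<forall>x\<in>U. \<exists>l. cylinder x l \<subseteq> U" "chain_action \<Gamma> G g x \<in> U"
  then obtain l where l: "cylinder (chain_action \<Gamma> G g x) l \<subseteq> U" by blast
  have "chain_action \<Gamma> G g y \<in> cylinder (chain_action \<Gamma> G g x) l" if "y \<in> cylinder x l" for y
    using that assms x by (simp add: cylinder_def chain_action_eq translate_in_points)
  then show "\<exists>l. cylinder x l \<subseteq> {x \<in> points. chain_action \<Gamma> G g x \<in> U}"
    using l by (intro exI[of _ l]) (auto simp: cylinder_def)
qed

lemma homeomorphic_map_chain_action:
  assumes "g \<in> carrier \<Gamma>"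
  shows "homeomorphic_map (chain_space \<Gamma> G) (chain_space \<Gamma> G) (chain_action \<Gamma> G g)"
  using assms unfolding homeomorphic_map_maps homeomorphic_maps_def
  by (intro exI[of _ "chain_action \<Gamma> G (inv g)"])
     (simp add: continuous_map_chain_action chain_action_inv)

section \<open>Action axioms, minimality and the Cantor property\<close>

lemma group_action_chain_action: "group_action \<Gamma> points (chain_action \<Gamma> G)"
proof -
  have bij: "chain_action \<Gamma> G g \<in> Bij points" if "g \<in> carrier \<Gamma>" for g
    unfolding Bij_def
  proof (intro IntI CollectI)
    show "chain_action \<Gamma> G g \<in> extensional points"
      by (simp add: chain_action_def)
    show "bij_betw (chain_action \<Gamma> G g) points points"
      by (rule bij_betw_byWitness[of _ "chain_action \<Gamma> G (inv g)"])
         (use that chain_action_inv chain_action_in_points in auto)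
  qed
  have "chain_action \<Gamma> G \<in> hom \<Gamma> (BijGroup points)"
  proof (rule homI)
    show "chain_action \<Gamma> G g \<in> carrier (BijGroup points)" if "g \<in> carrier \<Gamma>" for g
      using bij[OF that] by (simp add: BijGroup_def)
    fix g h assume gh: "g \<in> carrier \<Gamma>" "h \<in> carrier \<Gamma>"
    have "chain_action \<Gamma> G (g \<otimes> h) = compose points (chain_action \<Gamma> G g) (chain_action \<Gamma> G h)"
      by (rule extensionalityI[of _ points])
         (use gh in \<open>auto simp: chain_action_mult compose_def chain_action_def[of \<Gamma> G "g \<otimes> h"]\<close>)
    then show "chain_action \<Gamma> G (g \<otimes> h) =
        chain_action \<Gamma> G g \<otimes>\<^bsub>BijGroup points\<^esub> chain_action \<Gamma> G h"
      using gh bij by (simp add: BijGroup_def)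
  qed
  then show ?thesis
    by (simp add: group_action_def group_hom_def group_hom_axioms_def group_BijGroup is_group)
qed

text \<open>The action on each level is transitive: \<open>b \<otimes> inv a\<close> carries the
  coset of \<open>a\<close> to that of \<open>b\<close>. Every orbit therefore meets every
  cylinder.\<close>

lemma minimal_chain_action: "minimal_action \<Gamma> (chain_space \<Gamma> G) (chain_action \<Gamma> G)"
  unfolding minimal_action_def
proof (intro ballI equalityI subsetI)
  fix x z assume x: "x \<in> points" and z: "z \<in> points"
  show "z \<in> chain_space \<Gamma> G closure_of orbit \<Gamma> (chain_action \<Gamma> G) x"
    unfolding in_closure_of
  proof (intro conjI z allI impI, elim conjE)
    fix T assume "z \<in> T" "openin (chain_space \<Gamma> G) T"
    then obtain l where l: "cylinder z l \<subseteq> T"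
      unfolding openin_chain_space_iff by blast
    obtain a b where ab: "a \<in> carrier \<Gamma>" "b \<in> carrier \<Gamma>" "x l = a <# G l" "z l = b <# G l"
      using x z by (metis point_rep)
    let ?g = "b \<otimes> inv a"
    have "?g <# x l = z l"
      using ab G_subset by (simp add: lcos_m_assoc m_assoc)
    then have "chain_action \<Gamma> G ?g x \<in> cylinder z l"
      using ab x by (simp add: cylinder_def chain_action_eq translate_in_points)
    moreover have "chain_action \<Gamma> G ?g x \<in> orbit \<Gamma> (chain_action \<Gamma> G) x"
      using ab unfolding orbit_def by blast
    ultimately show "\<exists>y. y \<in> orbit \<Gamma> (chain_action \<Gamma> G) x \<and> y \<in> T"
      using l by blast
  qed
next
  fix x z assume "z \<in> chain_space \<Gamma> G closure_of orbit \<Gamma> (chain_action \<Gamma> G) x"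
  then show "z \<in> points"
    using closure_of_subset_topspace[of "chain_space \<Gamma> G"] by blast
qed

text \<open>Clopen cylinders separate points, which makes connected sets trivial; strictness of the
  chain produces a second point inside each cylinder, so no point is isolated.\<close>

lemma cantor_chain_space:
  assumes proper: "\<And>l. G (Suc l) \<noteq> G l"
  shows "cantor_space (chain_space \<Gamma> G)"
  unfolding cantor_space_def
proof (intro conjI allI impI ballI)
  show "points \<noteq> {}"
    using base_orbit_in_points[of \<one>] by auto
  show "compact_space (chain_space \<Gamma> G)"
    by (rule compact_chain_space)
  show "metrizable_space (chain_space \<Gamma> G)"
    unfolding metrizable_space_def using Metric_space_cdist mtopology_cdist by metis
next
  fix S assume S: "connectedin (chain_space \<Gamma> G) S"
  have "x = y" if xy: "x \<in> S" "y \<in> S" for x y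
  proof
    fix l
    have "x \<in> points"
      using S xy connectedin_subset_topspace by blast
    then have "\<not> disjnt S (cylinder x l)"
      using xy cylinder_refl by (auto simp: disjnt_iff)
    then have "S \<subseteq> cylinder x l"
      using connectedin_clopen_cases[OF S closedin_cylinder openin_cylinder] by blast
    then show "x l = y l"
      using xy by (auto simp: cylinder_def)
  qed
  then show "\<exists>a. S \<subseteq> {a}" by blast
next
  fix x assume x: "x \<in> points"
  show "\<not> openin (chain_space \<Gamma> G) {x}"
  proof
    assume "openin (chain_space \<Gamma> G) {x}"
    then obtain l where l: "cylinder x l \<subseteq> {x}"
      unfolding openin_chain_space_iff by blast
    obtain a where a: "a \<in> carrier \<Gamma>" "x l = a <# G l"
      using x point_rep by metis
    \<comment> \<open>Such a \<open>g\<close> separates the two levels: the points given by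
      \<open>a\<close> and \<open>a \<otimes> g\<close> agree at \<open>l\<close> but not at
      \<open>Suc l\<close>.\<close>
    obtain g where g: "g \<in> G l" "g \<notin> G (Suc l)"
      using proper[of l] G_Suc_subset[of l] by blast
    have gc: "g \<in> carrier \<Gamma>"
      using g G_subset by blast
    have "(a \<otimes> g) <# G l = a <# G l" "(a \<otimes> g) <# G (Suc l) \<noteq> a <# G (Suc l)"
    proof -
      have "inv (a \<otimes> g) \<otimes> a = inv g"
        using a gc by (simp add: inv_mult_group m_assoc)
      moreover have "inv g \<in> G l"
        by (rule subgroup.m_inv_closed[OF subgroup_G g(1)])
      moreover have "inv g \<notin> G (Suc l)"
        using subgroup.m_inv_closed[OF subgroup_G, of "inv g" "Suc l"] g(2) gc by auto
      ultimately show "(a \<otimes> g) <# G l = a <# G l" "(a \<otimes> g) <# G (Suc l) \<noteq> a <# G (Suc l)"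
        using a gc by (simp_all add: l_coset_eq_iff[OF subgroup_G])
    qed
    moreover have "(\<lambda>l. a <# G l) \<in> cylinder x l"
      using a base_orbit_in_points by (simp add: cylinder_def)
    ultimately have "(\<lambda>l. (a \<otimes> g) <# G l) \<in> cylinder x l" "(\<lambda>l. a <# G l) \<in> cylinder x l"
      using a gc base_orbit_in_points by (simp_all add: cylinder_def)
    then have "(\<lambda>l. (a \<otimes> g) <# G l) = (\<lambda>l. a <# G l)"
      using l by blast
    then show False
      using \<open>(a \<otimes> g) <# G (Suc l) \<noteq> a <# G (Suc l)\<close> by metis
  qed
qed

lemma odometer_chain:
  assumes "\<And>l. G (Suc l) \<noteq> G l"
  shows "odometer \<Gamma> (chain_space \<Gamma> G) (chain_action \<Gamma> G)"
proof -
  have "equicontinuous_action \<Gamma> (chain_space \<Gamma> G) (chain_action \<Gamma> G)"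
    unfolding equicontinuous_action_def
    by (intro exI[of _ cdist] conjI Metric_space_cdist mtopology_cdist) (auto simp: cdist_translate)
  then show ?thesis
    unfolding odometer_def cantor_action_def
    using cantor_chain_space[OF assms] group_action_chain_action homeomorphic_map_chain_action
      minimal_chain_action by blast
qed

end

section \<open>Corresponding group chains\<close>

text \<open>For \<open>c = a <# G l\<close> this is the conjugate of \<open>G l\<close> by
  \<open>a\<close>. Along the coordinates of a point \<open>x\<close> it gives a descending sequence
  of subgroups, the chain as seen from the base point \<open>x\<close>.\<close>

definition coset_stabilizer :: "('a, 'm) monoid_scheme \<Rightarrow> 'a set \<Rightarrow> 'a set" where
  "coset_stabilizer \<Gamma> c = {g \<in> carrier \<Gamma>. g <#\<^bsub>\<Gamma>\<^esub> c = c}"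

text \<open>The order of the class of \<open>g\<close> modulo the core of \<open>G l\<close>, in the
  form in which it occurs in \<open>element_type\<close>.\<close>

definition level_order :: "('a, 'm) monoid_scheme \<Rightarrow> (nat \<Rightarrow> 'a set) \<Rightarrow> nat \<Rightarrow> 'a \<Rightarrow> nat" where
  "level_order \<Gamma> G l g =
     order (\<Gamma>\<lparr>carrier := generate \<Gamma> {g}\<rparr> Mod (generate \<Gamma> {g} \<inter> normal_core \<Gamma> (G l)))"

text \<open>The condition on \<open>z\<close> says that it fixes the coset of \<open>e\<close>
  modulo \<open>G M\<close> for every \<open>e \<in> G q\<close>. For \<open>M \<ge> q\<close> this
  means acting trivially, to depth \<open>M\<close>, on the cylinder of level \<open>q\<close>
  around the identity cosets; the property asks that this force trivial action on all of level
  \<open>m\<close>.\<close>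

definition locally_determined_core ::
    "('a, 'm) monoid_scheme \<Rightarrow> (nat \<Rightarrow> 'a set) \<Rightarrow> nat \<Rightarrow> bool" where
  "locally_determined_core \<Gamma> G q \<longleftrightarrow>
     (\<forall>m. \<exists>M. \<forall>z\<in>carrier \<Gamma>.
        (\<forall>e\<in>G q. inv\<^bsub>\<Gamma>\<^esub> e \<otimes>\<^bsub>\<Gamma>\<^esub> z \<otimes>\<^bsub>\<Gamma>\<^esub> e \<in> G M) \<longrightarrow> z \<in> normal_core \<Gamma> (G m))"

lemma dvd_mult_iff_div_gcd:
  fixes a n j :: nat
  assumes "a > 0"
  shows "a dvd n * j \<longleftrightarrow> a div gcd a n dvd j"
proof -
  let ?g = "gcd a n"
  have g: "?g > 0" using assms by simp
  have cop: "coprime (a div ?g) (n div ?g)"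
    using assms by (intro div_gcd_coprime) simp
  have "a dvd n * j \<longleftrightarrow> ?g * (a div ?g) dvd ?g * ((n div ?g) * j)"
    by (simp add: mult.assoc [symmetric])
  also have "\<dots> \<longleftrightarrow> a div ?g dvd (n div ?g) * j"
    using g by (simp only: nat_mult_dvd_cancel1)
  also have "\<dots> \<longleftrightarrow> a div ?g dvd j"
    using cop by (rule coprime_dvd_mult_right_iff)
  finally show ?thesis .
qed

context coset_chain
begin

section \<open>Orders of elements modulo the cores\<close>

lemma normal_core_antimono:
  assumes "i \<le> j"
  shows "normal_core \<Gamma> (G j) \<subseteq> normal_core \<Gamma> (G i)"
  using subsetD[OF G_antimono[OF assms]] by (auto simp: mem_normal_core_iff[OF subgroup_G])

lemma level_order:
  assumes "g \<in> carrier \<Gamma>"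
  shows "level_order \<Gamma> G l g \<ge> 1"
    and "g [^] (n::nat) \<in> normal_core \<Gamma> (G l) \<longleftrightarrow> level_order \<Gamma> G l g dvd n"
proof -
  note ex = ex_power_in_normal_core[OF subgroup_G finite_lcosets_G assms, of l]
  note order_cyclic_Mod[OF assms subgroup_normal_core[OF subgroup_G] ex]
  then show "level_order \<Gamma> G l g \<ge> 1"
    and "g [^] n \<in> normal_core \<Gamma> (G l) \<longleftrightarrow> level_order \<Gamma> G l g dvd n"
    unfolding level_order_def by blast+
qed

lemma power_level_order:
  "g \<in> carrier \<Gamma> \<Longrightarrow> g [^] level_order \<Gamma> G l g \<in> normal_core \<Gamma> (G l)"
  by (simp add: level_order)

lemma level_order_dvd:
  assumes "g \<in> carrier \<Gamma>" "i \<le> j"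
  shows "level_order \<Gamma> G i g dvd level_order \<Gamma> G j g"
  using power_level_order[OF assms(1), of j] normal_core_antimono[OF assms(2)]
  by (auto simp flip: level_order(2)[OF assms(1)])

text \<open>The power of \<open>g [^] n\<close> with exponent \<open>j\<close> lies in the core
  exactly when the order of \<open>g\<close> divides \<open>n * j\<close>. Both sides therefore have
  the same multiples and are equal.\<close>

lemma level_order_power:
  assumes g: "g \<in> carrier \<Gamma>"
  shows "level_order \<Gamma> G l (g [^] (n::nat)) =
    level_order \<Gamma> G l g div gcd (level_order \<Gamma> G l g) n"
proof -
  have "level_order \<Gamma> G l (g [^] n) dvd j \<longleftrightarrow>
      level_order \<Gamma> G l g div gcd (level_order \<Gamma> G l g) n dvd j" for j
  proof -
    have "level_order \<Gamma> G l (g [^] n) dvd j \<longleftrightarrow> (g [^] n) [^] j \<in> normal_core \<Gamma> (G l)"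
      using g by (simp add: level_order)
    also have "\<dots> \<longleftrightarrow> level_order \<Gamma> G l g dvd n * j"
      using g by (simp add: nat_pow_pow level_order)
    also have "\<dots> \<longleftrightarrow> level_order \<Gamma> G l g div gcd (level_order \<Gamma> G l g) n dvd j"
      using level_order(1)[OF g, of l] by (intro dvd_mult_iff_div_gcd) simp
    finally show ?thesis .
  qed
  then show ?thesis
    by (meson dvd_antisym dvd_refl)
qed

lemma element_type_eq:
  "element_type \<Gamma> G g = type_of_steinitz (steinitz_lcm ((\<lambda>l. level_order \<Gamma> G l g) ` {0<..}))"
proof -
  have "{level_order \<Gamma> G l g | l. l > 0} = (\<lambda>l. level_order \<Gamma> G l g) ` {0<..}"
    by auto
  then show ?thesis
    unfolding element_type_def level_order_def by simp
qed

text \<open>The orders of \<open>g\<close> and \<open>g\<^sup>n\<close> at level \<open>l\<close> differ by the factor \<open>gcd(o\<^sub>l, n)\<close>, which is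
  increasing in \<open>l\<close> for divisibility and bounded by \<open>n\<close>, hence eventually constant.\<close>

lemma element_type_power:
  assumes g: "g \<in> carrier \<Gamma>" and n: "n \<ge> 1"
  shows "element_type \<Gamma> G (g [^] (n::nat)) = element_type \<Gamma> G g"
proof -
  let ?a = "\<lambda>l. level_order \<Gamma> G l g" and ?b = "\<lambda>l. level_order \<Gamma> G l (g [^] n)"
  have gn: "g [^] n \<in> carrier \<Gamma>"
    using g by simp
  have "\<exists>L. True \<and> (\<forall>l. True \<longrightarrow> gcd (?a l) n \<le> gcd (?a L) n)"
    by (rule ex_has_greatest_nat[where b = "Suc n"]) (use n in \<open>auto simp: less_Suc_eq_le intro: gcd_le2_nat\<close>)
  then obtain L where L: "gcd (?a l) n \<le> gcd (?a L) n" for l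
    by blast
  define d where "d = gcd (?a L) n"
  have d1: "d \<ge> 1"
    using n by (simp add: d_def Suc_le_eq)
  have ab: "?a l = d * ?b l" if "L \<le> l" for l
  proof -
    have "gcd (?a L) n dvd gcd (?a l) n"
      using level_order_dvd[OF g that] by (simp add: gcd_dvdI1 gcd_mono)
    then have "gcd (?a l) n = d"
      using L[of l] n by (metis d_def dvd_imp_le gcd_pos_nat le_antisym less_le_trans zero_less_one neq0_conv not_one_le_zero)
    then show ?thesis
      by (metis level_order_power[OF g] dvd_mult_div_cancel gcd_dvd1)
  qed
  have "type_of_steinitz (steinitz_lcm (?b ` {0<..})) = type_of_steinitz (steinitz_lcm (?a ` {0<..}))"
  proof (rule type_of_lcm_eqI[of d 1])
    fix b assume "b \<in> ?b ` {0<..}"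
    then obtain l where l: "l > 0" "b = ?b l" by blast
    have "d * b dvd d * ?b (max l L)"
      using level_order_dvd[OF gn, of l "max l L"] l by simp
    also have "d * ?b (max l L) = ?a (max l L)"
      using ab[of "max l L"] by simp
    finally show "\<exists>a\<in>?a ` {0<..}. d * b dvd 1 * a"
      using l by (intro bexI[of _ "?a (max l L)"]) auto
  next
    fix a assume "a \<in> ?a ` {0<..}"
    then obtain l where l: "l > 0" "a = ?a l" by blast
    have "a dvd ?a (max l L)"
      using level_order_dvd[OF g, of l "max l L"] l by simp
    also have "?a (max l L) = d * ?b (max l L)"
      using ab[of "max l L"] by simp
    finally show "\<exists>b\<in>?b ` {0<..}. 1 * a dvd d * b"
      using l by (intro bexI[of _ "?b (max l L)"]) auto
  qed (use d1 level_order(1)[OF g] level_order(1)[OF gn] in auto)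
  then show ?thesis
    by (simp add: element_type_eq)
qed

section \<open>Stabilizers along the coordinates of a point\<close>

lemma mem_coset_stabilizer_iff:
  "a \<in> carrier \<Gamma> \<Longrightarrow>
    g \<in> coset_stabilizer \<Gamma> (a <# G l) \<longleftrightarrow> g \<in> carrier \<Gamma> \<and> inv a \<otimes> g \<otimes> a \<in> G l"
  using conj_mem_iff_l_coset_fixed[OF subgroup_G] by (auto simp: coset_stabilizer_def)

lemma subgroup_coset_stabilizer:
  assumes "x \<in> points"
  shows "subgroup (coset_stabilizer \<Gamma> (x l)) \<Gamma>"
proof
  fix g assume g: "g \<in> coset_stabilizer \<Gamma> (x l)"
  then have "g \<in> carrier \<Gamma>" "g <# x l = x l"
    by (simp_all add: coset_stabilizer_def)
  moreover have "inv g <# (g <# x l) = (inv g \<otimes> g) <# x l"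
    using calculation(1) by (intro lcos_m_assoc point_subset[OF assms]) simp_all
  ultimately show "inv g \<in> coset_stabilizer \<Gamma> (x l)"
    using point_subset[OF assms, of l] by (simp add: coset_stabilizer_def lcos_mult_one)
qed (use point_subset[OF assms] in
  \<open>auto simp: coset_stabilizer_def lcos_mult_one simp flip: lcos_m_assoc\<close>)

lemma coset_stabilizer_antimono:
  assumes "x \<in> points" "i \<le> j"
  shows "coset_stabilizer \<Gamma> (x j) \<subseteq> coset_stabilizer \<Gamma> (x i)"
proof
  fix g assume g: "g \<in> coset_stabilizer \<Gamma> (x j)"
  then have "(\<lambda>l. g <# x l) \<in> points" "g <# x j = x j"
    using assms translate_in_points by (auto simp: coset_stabilizer_def)
  then have "g <# x i = x i"
    using points_agree_le[OF _ assms(1), of "\<lambda>l. g <# x l" j i] assms(2) by simp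
  then show "g \<in> coset_stabilizer \<Gamma> (x i)"
    using g by (simp add: coset_stabilizer_def)
qed

lemma l_coset_stabilizer_eq_iff:
  assumes "x \<in> points" "g \<in> carrier \<Gamma>" "k \<in> carrier \<Gamma>"
  shows "g <# coset_stabilizer \<Gamma> (x l) = k <# coset_stabilizer \<Gamma> (x l) \<longleftrightarrow> g <# x l = k <# x l"
proof -
  have sub: "x l \<subseteq> carrier \<Gamma>"
    using assms(1) by (rule point_subset)
  have "g <# coset_stabilizer \<Gamma> (x l) = k <# coset_stabilizer \<Gamma> (x l) \<longleftrightarrow>
      (inv g \<otimes> k) <# x l = x l"
    using assms by (simp add: l_coset_eq_iff[OF subgroup_coset_stabilizer]) (simp add: coset_stabilizer_def)
  also have "\<dots> \<longleftrightarrow> g <# ((inv g \<otimes> k) <# x l) = g <# x l"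
    using assms sub by (simp add: l_coset_cancel l_coset_subset_G)
  also have "g <# ((inv g \<otimes> k) <# x l) = k <# x l"
    using assms sub by (simp add: lcos_m_assoc m_assoc [symmetric])
  finally show ?thesis by auto
qed

text \<open>Orbit-stabilizer for the transitive action on the cosets of \<open>G l\<close>. Indices
  may thus be counted around any base point.\<close>

lemma card_lcosets_coset_stabilizer:
  assumes x: "x \<in> points"
  shows "card ((\<lambda>g. g <# coset_stabilizer \<Gamma> (x l)) ` carrier \<Gamma>) = card (lcosets (G l))"
proof -
  obtain a where a: "a \<in> carrier \<Gamma>" "x l = a <# G l"
    using x by (rule point_rep)
  have "b <# G l \<in> (\<lambda>g. g <# x l) ` carrier \<Gamma>" if b: "b \<in> carrier \<Gamma>" for b
  proof (rule image_eqI)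
    show "b <# G l = (b \<otimes> inv a) <# x l"
      using a b G_subset by (simp add: lcos_m_assoc m_assoc)
  qed (use a b in simp)
  then have "(\<lambda>g. g <# x l) ` carrier \<Gamma> = lcosets (G l)"
    using a G_subset by (auto simp: lcosets_image lcos_m_assoc)
  moreover have "card ((\<lambda>g. g <# coset_stabilizer \<Gamma> (x l)) ` carrier \<Gamma>) =
      card ((\<lambda>g. g <# x l) ` carrier \<Gamma>)"
    by (rule card_image_eq) (rule l_coset_stabilizer_eq_iff[OF x])
  ultimately show ?thesis by simp
qed

lemma card_lcosets_G_pos: "card (lcosets (G l)) \<ge> 1"
proof -
  have "\<one> <# G l \<in> lcosets (G l)"
    by (simp add: lcosetsI)
  then show ?thesis
    using finite_lcosets_G[of l] by (metis One_nat_def Suc_leI card_gt_0_iff empty_iff)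
qed

lemma card_lcosets_G_dvd:
  assumes "i \<le> j"
  shows "card (lcosets (G i)) dvd card (lcosets (G j))"
  unfolding lcosets_image
  using card_lcosets_tower[OF subgroup_self subgroup_G subgroup_G G_subset G_antimono[OF assms]]
  by simp

text \<open>For \<open>q = 0\<close> the conjugating elements run over the whole group, so the
  condition at \<open>M = m\<close> is core membership itself. This case serves the comparison of
  two models of one odometer.\<close>

lemma locally_determined_core_0: "locally_determined_core \<Gamma> G 0"
  unfolding locally_determined_core_def
  by (auto simp: G_0 mem_normal_core_iff[OF subgroup_G])

end

text \<open>\<open>R\<close> stands in for an isomorphism between finite index subgroups. It is a
  subgroup of the product, expressed by closure under quotients, but possibly multivalued in both
  directions, since distinct elements may induce the same map. \<open>domain\<close> and
  \<open>range\<close> make its projections contain deep stabilizers; \<open>forward\<close> and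
  \<open>backward\<close> say that it respects the two stabilizer filtrations.\<close>

locale chain_correspondence = A: coset_chain \<Gamma> G + B: coset_chain \<Delta> H
  for \<Gamma> :: "('a, 'm) monoid_scheme" and G
    and \<Delta> :: "('b, 'n) monoid_scheme" and H +
  fixes x :: "nat \<Rightarrow> 'a set" and y :: "nat \<Rightarrow> 'b set" and R :: "('a \<times> 'b) set"
  assumes x: "x \<in> topspace (chain_space \<Gamma> G)" and y: "y \<in> topspace (chain_space \<Delta> H)"
    and R_subset: "R \<subseteq> carrier \<Gamma> \<times> carrier \<Delta>"
    and R_quotient: "\<And>g g' k k'. (g, g') \<in> R \<Longrightarrow> (k, k') \<in> R \<Longrightarrow>
      (inv\<^bsub>\<Gamma>\<^esub> g \<otimes>\<^bsub>\<Gamma>\<^esub> k, inv\<^bsub>\<Delta>\<^esub> g' \<otimes>\<^bsub>\<Delta>\<^esub> k') \<in> R"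
    and domain: "\<exists>q. coset_stabilizer \<Gamma> (x q) \<subseteq> fst ` R"
    and range: "\<exists>q. coset_stabilizer \<Delta> (y q) \<subseteq> snd ` R"
    and forward: "\<And>m. \<exists>l. \<forall>g g'. (g, g') \<in> R \<longrightarrow>
      g \<in> coset_stabilizer \<Gamma> (x l) \<longrightarrow> g' \<in> coset_stabilizer \<Delta> (y m)"
    and backward: "\<And>l. \<exists>m. \<forall>g g'. (g, g') \<in> R \<longrightarrow>
      g' \<in> coset_stabilizer \<Delta> (y m) \<longrightarrow> g \<in> coset_stabilizer \<Gamma> (x l)"
begin

text \<open>The hypotheses are symmetric in the two chains, so the one-sided estimates below are
  used a second time through \<open>rev\<close>.\<close>

lemma converse: "chain_correspondence \<Delta> H \<Gamma> G y x (R\<inverse>)"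
proof -
  have "fst ` R\<inverse> = snd ` R" "snd ` R\<inverse> = fst ` R"
    by force+
  moreover have "\<exists>l. \<forall>g g'. (g', g) \<in> R \<longrightarrow>
      g \<in> coset_stabilizer \<Delta> (y l) \<longrightarrow> g' \<in> coset_stabilizer \<Gamma> (x m)" for m
    using backward[of m] by blast
  moreover have "\<exists>m. \<forall>g g'. (g', g) \<in> R \<longrightarrow>
      g' \<in> coset_stabilizer \<Gamma> (x m) \<longrightarrow> g \<in> coset_stabilizer \<Delta> (y l)" for l
    using forward[of l] by blast
  ultimately show ?thesis
    using R_subset R_quotient domain range x y by unfold_locales auto
qed

lemma R_carrier: "(g, g') \<in> R \<Longrightarrow> g \<in> carrier \<Gamma>" "(g, g') \<in> R \<Longrightarrow> g' \<in> carrier \<Delta>"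
  using R_subset by blast+

text \<open>\<open>domain\<close> puts the unit into the first projection; the quotient of such a
  pair with itself is the pair of units.\<close>

lemma R_one: "(\<one>\<^bsub>\<Gamma>\<^esub>, \<one>\<^bsub>\<Delta>\<^esub>) \<in> R"
proof -
  obtain q where "coset_stabilizer \<Gamma> (x q) \<subseteq> fst ` R"
    using domain by blast
  then have "\<one>\<^bsub>\<Gamma>\<^esub> \<in> fst ` R"
    using subgroup.one_closed[OF A.subgroup_coset_stabilizer[OF x]] by blast
  then obtain g' where "(\<one>\<^bsub>\<Gamma>\<^esub>, g') \<in> R" by force
  then show ?thesis
    using R_quotient[of "\<one>\<^bsub>\<Gamma>\<^esub>" g' "\<one>\<^bsub>\<Gamma>\<^esub>" g'] R_carrier(2) by simp
qed

lemma R_inv: "(g, g') \<in> R \<Longrightarrow> (inv\<^bsub>\<Gamma>\<^esub> g, inv\<^bsub>\<Delta>\<^esub> g') \<in> R"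
  using R_quotient[OF _ R_one, of g g'] R_carrier[of g g'] by simp

lemma R_mult:
  assumes "(g, g') \<in> R" "(k, k') \<in> R"
  shows "(g \<otimes>\<^bsub>\<Gamma>\<^esub> k, g' \<otimes>\<^bsub>\<Delta>\<^esub> k') \<in> R"
  using R_quotient[OF R_inv[OF assms(1)] assms(2)] R_carrier[OF assms(1)] by simp

lemma R_pow: "(g, g') \<in> R \<Longrightarrow> (g [^]\<^bsub>\<Gamma>\<^esub> (n::nat), g' [^]\<^bsub>\<Delta>\<^esub> n) \<in> R"
  by (induction n) (simp_all add: R_one R_mult)

lemma subgroup_domain: "subgroup (fst ` R) \<Gamma>"
proof
  show "fst ` R \<subseteq> carrier \<Gamma>"
    using R_subset by auto
  show "\<one>\<^bsub>\<Gamma>\<^esub> \<in> fst ` R"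
    using R_one by force
  show "g \<otimes>\<^bsub>\<Gamma>\<^esub> k \<in> fst ` R" if "g \<in> fst ` R" "k \<in> fst ` R" for g k
    using that R_mult by force
  show "inv\<^bsub>\<Gamma>\<^esub> g \<in> fst ` R" if "g \<in> fst ` R" for g
    using that R_inv by force
qed

section \<open>Comparison of indices and types\<close>

lemma card_lcosets_domain:
  assumes "coset_stabilizer \<Gamma> (x l) \<subseteq> fst ` R"
  shows "card (lcosets\<^bsub>\<Gamma>\<^esub> (G l)) =
    card ((\<lambda>g. g <#\<^bsub>\<Gamma>\<^esub> fst ` R) ` carrier \<Gamma>) *
    card ((\<lambda>g. g <#\<^bsub>\<Gamma>\<^esub> coset_stabilizer \<Gamma> (x l)) ` fst ` R)"
  using A.card_lcosets_tower[OF A.subgroup_self subgroup_domain A.subgroup_coset_stabilizer[OF x]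
      subgroup.subset[OF subgroup_domain] assms]
  by (simp add: A.card_lcosets_coset_stabilizer[OF x])

lemma forward_le:
  "\<exists>l\<ge>L. \<forall>g g'. (g, g') \<in> R \<longrightarrow>
     g \<in> coset_stabilizer \<Gamma> (x l) \<longrightarrow> g' \<in> coset_stabilizer \<Delta> (y m)"
proof -
  obtain l where "\<forall>g g'. (g, g') \<in> R \<longrightarrow>
      g \<in> coset_stabilizer \<Gamma> (x l) \<longrightarrow> g' \<in> coset_stabilizer \<Delta> (y m)"
    using forward by blast
  then show ?thesis
    using A.coset_stabilizer_antimono[OF x, of l "max l L"] by (intro exI[of _ "max l L"]) auto
qed

lemma domain_le: "\<exists>l\<ge>L. coset_stabilizer \<Gamma> (x l) \<subseteq> fst ` R"
proof -
  obtain q where "coset_stabilizer \<Gamma> (x q) \<subseteq> fst ` R"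
    using domain by blast
  then show ?thesis
    using A.coset_stabilizer_antimono[OF x, of q "max q L"] by (intro exI[of _ "max q L"]) auto
qed

text \<open>The \<open>R\<close>-preimage \<open>T\<close> of the target stabilizer
  \<open>S'\<close> lies between a deep source stabilizer \<open>S\<close> and the domain. Its index
  in the domain is the number of cosets of \<open>S'\<close> meeting the range, and the index of
  \<open>S\<close> is a multiple of it.\<close>

lemma index_dvd:
  "\<exists>l\<ge>L. coset_stabilizer \<Gamma> (x l) \<subseteq> fst ` R \<and>
     card ((\<lambda>g. g <#\<^bsub>\<Delta>\<^esub> coset_stabilizer \<Delta> (y m)) ` snd ` R) dvd
     card ((\<lambda>g. g <#\<^bsub>\<Gamma>\<^esub> coset_stabilizer \<Gamma> (x l)) ` fst ` R)"
proof -
  obtain q where q: "q \<ge> L" "coset_stabilizer \<Gamma> (x q) \<subseteq> fst ` R"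
    using domain_le by blast
  obtain l where l: "l \<ge> q" "\<And>g g'. (g, g') \<in> R \<Longrightarrow>
      g \<in> coset_stabilizer \<Gamma> (x l) \<Longrightarrow> g' \<in> coset_stabilizer \<Delta> (y m)"
    using forward_le by blast
  define S where "S = coset_stabilizer \<Gamma> (x l)"
  define S' where "S' = coset_stabilizer \<Delta> (y m)"
  define T where "T = {g. \<exists>g'\<in>S'. (g, g') \<in> R}"
  have S: "subgroup S \<Gamma>" and S': "subgroup S' \<Delta>"
    unfolding S_def S'_def
    using A.subgroup_coset_stabilizer[OF x] B.subgroup_coset_stabilizer[OF y] by blast+
  have SR: "S \<subseteq> fst ` R"
    unfolding S_def using A.coset_stabilizer_antimono[OF x l(1)] q(2) by blast
  have ST: "S \<subseteq> T"
  proof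
    fix g assume g: "g \<in> S"
    then obtain g' where "(g, g') \<in> R"
      using SR by force
    then show "g \<in> T"
      using l(2) g unfolding T_def S_def S'_def by blast
  qed
  have TR: "T \<subseteq> fst ` R"
    unfolding T_def by force
  have T: "subgroup T \<Gamma>"
  proof
    show "T \<subseteq> carrier \<Gamma>"
      unfolding T_def using R_carrier(1) by blast
    show "\<one>\<^bsub>\<Gamma>\<^esub> \<in> T"
      using R_one subgroup.one_closed[OF S'] unfolding T_def by blast
    show "g \<otimes>\<^bsub>\<Gamma>\<^esub> k \<in> T" if "g \<in> T" "k \<in> T" for g k
      using that R_mult subgroup.m_closed[OF S'] unfolding T_def by blast
    show "inv\<^bsub>\<Gamma>\<^esub> g \<in> T" if "g \<in> T" for g
      using that R_inv subgroup.m_inv_closed[OF S'] unfolding T_def by blast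
  qed
  \<comment> \<open>One \<open>g\<close> may have several partners. Two of them differ by a partner
    of the unit, which \<open>forward\<close> places in \<open>S'\<close> since the unit lies in
    \<open>S\<close>; so membership in \<open>S'\<close> depends only on \<open>g\<close>.\<close>
  have T_iff: "g \<in> T \<longleftrightarrow> g' \<in> S'" if gg: "(g, g') \<in> R" for g g'
  proof
    assume "g \<in> T"
    then obtain h where h: "h \<in> S'" "(g, h) \<in> R"
      unfolding T_def by blast
    have "(\<one>\<^bsub>\<Gamma>\<^esub>, inv\<^bsub>\<Delta>\<^esub> h \<otimes>\<^bsub>\<Delta>\<^esub> g') \<in> R"
      using R_quotient[OF h(2) gg] R_carrier[OF gg] by simp
    then have "inv\<^bsub>\<Delta>\<^esub> h \<otimes>\<^bsub>\<Delta>\<^esub> g' \<in> S'"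
      using l(2) subgroup.one_closed[OF S] unfolding S_def S'_def by blast
    then have "h \<otimes>\<^bsub>\<Delta>\<^esub> (inv\<^bsub>\<Delta>\<^esub> h \<otimes>\<^bsub>\<Delta>\<^esub> g') \<in> S'"
      using h subgroup.m_closed[OF S'] by blast
    then show "g' \<in> S'"
      using R_carrier[OF gg] R_carrier[OF h(2)] by (simp add: B.m_assoc [symmetric])
  qed (use gg in \<open>auto simp: T_def\<close>)
  have "card ((\<lambda>g. g <#\<^bsub>\<Gamma>\<^esub> T) ` fst ` R) = card ((\<lambda>g. g <#\<^bsub>\<Delta>\<^esub> S') ` snd ` R)"
  proof (rule card_image_eq_via_relation)
    fix a b c d assume ab: "(a, b) \<in> R" and cd: "(c, d) \<in> R"
    show "a <#\<^bsub>\<Gamma>\<^esub> T = c <#\<^bsub>\<Gamma>\<^esub> T \<longleftrightarrow> b <#\<^bsub>\<Delta>\<^esub> S' = d <#\<^bsub>\<Delta>\<^esub> S'"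
      using R_carrier[OF ab] R_carrier[OF cd] T_iff[OF R_quotient[OF ab cd]]
      by (simp add: A.l_coset_eq_iff[OF T] B.l_coset_eq_iff[OF S'])
  qed
  then have "card ((\<lambda>g. g <#\<^bsub>\<Gamma>\<^esub> S) ` fst ` R) =
      card ((\<lambda>g. g <#\<^bsub>\<Delta>\<^esub> S') ` snd ` R) * card ((\<lambda>g. g <#\<^bsub>\<Gamma>\<^esub> S) ` T)"
    using A.card_lcosets_tower[OF subgroup_domain T S TR ST] by simp
  then show ?thesis
    using q l(1) SR unfolding S_def S'_def by (intro exI[of _ l]) simp
qed

text \<open>Each index is that of the domain or range of \<open>R\<close> times an index inside it,
  and the inner indices divide by \<open>index_dvd\<close>. Multiplying crosswise balances the two
  outer indices, which are independent of the level.\<close>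

lemma card_lcosets_cofinal:
  assumes "l > 0"
  shows "\<exists>m>0. card ((\<lambda>g. g <#\<^bsub>\<Delta>\<^esub> snd ` R) ` carrier \<Delta>) * card (lcosets\<^bsub>\<Gamma>\<^esub> (G l)) dvd
    card ((\<lambda>g. g <#\<^bsub>\<Gamma>\<^esub> fst ` R) ` carrier \<Gamma>) * card (lcosets\<^bsub>\<Delta>\<^esub> (H m))"
proof -
  interpret rev: chain_correspondence \<Delta> H \<Gamma> G y x "R\<inverse>"
    by (rule converse)
  have R': "fst ` R\<inverse> = snd ` R" "snd ` R\<inverse> = fst ` R"
    by force+
  let ?kA = "card ((\<lambda>g. g <#\<^bsub>\<Gamma>\<^esub> fst ` R) ` carrier \<Gamma>)"
  let ?kB = "card ((\<lambda>g. g <#\<^bsub>\<Delta>\<^esub> snd ` R) ` carrier \<Delta>)"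
  obtain l' where l': "l' \<ge> l" "coset_stabilizer \<Gamma> (x l') \<subseteq> fst ` R"
    using domain_le by blast
  \<comment> \<open>The bound 1 keeps \<open>m\<close> positive, as the least common multiples range
    over positive levels.\<close>
  obtain m where m: "m \<ge> 1" "coset_stabilizer \<Delta> (y m) \<subseteq> snd ` R"
    and dvd: "card ((\<lambda>g. g <#\<^bsub>\<Gamma>\<^esub> coset_stabilizer \<Gamma> (x l')) ` fst ` R) dvd
      card ((\<lambda>g. g <#\<^bsub>\<Delta>\<^esub> coset_stabilizer \<Delta> (y m)) ` snd ` R)"
    using rev.index_dvd[of 1 l'] unfolding R' by blast
  have "?kB * card (lcosets\<^bsub>\<Gamma>\<^esub> (G l)) dvd ?kB * card (lcosets\<^bsub>\<Gamma>\<^esub> (G l'))"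
    using A.card_lcosets_G_dvd[OF l'(1)] by simp
  also have "\<dots> = ?kA * (?kB * card ((\<lambda>g. g <#\<^bsub>\<Gamma>\<^esub> coset_stabilizer \<Gamma> (x l')) ` fst ` R))"
    by (simp add: card_lcosets_domain[OF l'(2)])
  also have "\<dots> dvd ?kA * (?kB * card ((\<lambda>g. g <#\<^bsub>\<Delta>\<^esub> coset_stabilizer \<Delta> (y m)) ` snd ` R))"
    using dvd by simp
  also have "\<dots> = ?kA * card (lcosets\<^bsub>\<Delta>\<^esub> (H m))"
    using rev.card_lcosets_domain[of m] m(2) unfolding R' by simp
  finally show ?thesis
    using m(1) by (intro exI[of _ m]) simp
qed

text \<open>The index of the domain is a factor of the positive number of cosets of some
  \<open>G q\<close>. In particular it is finite, infinite sets having cardinality 0.\<close>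

lemma index_domain_pos: "card ((\<lambda>g. g <#\<^bsub>\<Gamma>\<^esub> fst ` R) ` carrier \<Gamma>) \<ge> 1"
proof -
  obtain q where "coset_stabilizer \<Gamma> (x q) \<subseteq> fst ` R"
    using domain by blast
  from card_lcosets_domain[OF this] show ?thesis
    using A.card_lcosets_G_pos[of q] by (metis One_nat_def less_eq_Suc_le mult_0 not_gr_zero)
qed

lemma chain_type_eq: "chain_type \<Gamma> G = chain_type \<Delta> H"
proof -
  interpret rev: chain_correspondence \<Delta> H \<Gamma> G y x "R\<inverse>"
    by (rule converse)
  have R': "fst ` R\<inverse> = snd ` R" "snd ` R\<inverse> = fst ` R"
    by force+
  show ?thesis
    unfolding chain_type_def
  proof (rule type_of_lcm_eqI)
    show "card ((\<lambda>g. g <#\<^bsub>\<Delta>\<^esub> snd ` R) ` carrier \<Delta>) \<ge> 1"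
      using rev.index_domain_pos by (simp add: R')
    show "card ((\<lambda>g. g <#\<^bsub>\<Gamma>\<^esub> fst ` R) ` carrier \<Gamma>) \<ge> 1"
      by (rule index_domain_pos)
    fix n assume "n \<in> {card (lcosets\<^bsub>\<Gamma>\<^esub> (G l)) | l. l > 0}"
    then show "\<exists>n'\<in>{card (lcosets\<^bsub>\<Delta>\<^esub> (H l)) | l. l > 0}.
        card ((\<lambda>g. g <#\<^bsub>\<Delta>\<^esub> snd ` R) ` carrier \<Delta>) * n dvd
        card ((\<lambda>g. g <#\<^bsub>\<Gamma>\<^esub> fst ` R) ` carrier \<Gamma>) * n'"
      using card_lcosets_cofinal by blast
  next
    fix n' assume "n' \<in> {card (lcosets\<^bsub>\<Delta>\<^esub> (H l)) | l. l > 0}"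
    then show "\<exists>n\<in>{card (lcosets\<^bsub>\<Gamma>\<^esub> (G l)) | l. l > 0}.
        card ((\<lambda>g. g <#\<^bsub>\<Gamma>\<^esub> fst ` R) ` carrier \<Gamma>) * n' dvd
        card ((\<lambda>g. g <#\<^bsub>\<Delta>\<^esub> snd ` R) ` carrier \<Delta>) * n"
      using rev.card_lcosets_cofinal unfolding R' by blast
  qed (use A.card_lcosets_G_pos B.card_lcosets_G_pos in auto)
qed

section \<open>Comparison of orders and typesets\<close>

lemma level_order_cofinal:
  assumes core: "locally_determined_core \<Delta> H q" and q: "coset_stabilizer \<Delta> (y q) \<subseteq> snd ` R"
    and gg: "(g, g') \<in> R"
  shows "\<exists>l>0. level_order \<Delta> H m g' dvd level_order \<Gamma> G l g"
proof -
  note [simp] = R_carrier[OF gg]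
  obtain M0 where M0: "\<And>z. z \<in> carrier \<Delta> \<Longrightarrow>
      (\<forall>e\<in>H q. inv\<^bsub>\<Delta>\<^esub> e \<otimes>\<^bsub>\<Delta>\<^esub> z \<otimes>\<^bsub>\<Delta>\<^esub> e \<in> H M0) \<Longrightarrow> z \<in> normal_core \<Delta> (H m)"
    using core unfolding locally_determined_core_def by metis
  \<comment> \<open>\<open>M\<close> is at least \<open>q\<close> so that a representative of
    \<open>y M\<close> also represents \<open>y q\<close>; conjugation by it then moves both levels
    to the identity coset, where \<open>locally_determined_core\<close> is formulated.\<close>
  define M where "M = max M0 q"
  have HM: "H M \<subseteq> H M0" and qM: "q \<le> M"
    by (auto simp: M_def B.G_antimono)
  obtain l where l: "l \<ge> 1" "\<And>k k'. (k, k') \<in> R \<Longrightarrow>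
      k \<in> coset_stabilizer \<Gamma> (x l) \<Longrightarrow> k' \<in> coset_stabilizer \<Delta> (y M)"
    using forward_le by blast
  obtain a where a: "a \<in> carrier \<Delta>" "y M = a <#\<^bsub>\<Delta>\<^esub> H M"
    using y by (rule B.point_rep)
  have yq: "y q = a <#\<^bsub>\<Delta>\<^esub> H q"
    by (rule B.point_rep_le[OF y a qM])
  \<comment> \<open>The \<open>n\<close>-th power of \<open>g\<close> lies in the core of
    \<open>G l\<close>. Its conjugates by the domain of \<open>R\<close> therefore stabilize
    \<open>x l\<close>, so those of \<open>z\<close> by the range stabilize \<open>y M\<close>, and
    local determination places \<open>z\<close> in the core of \<open>H m\<close>.\<close>
  define n where "n = level_order \<Gamma> G l g"
  define z where "z = g' [^]\<^bsub>\<Delta>\<^esub> n"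
  have z: "z \<in> carrier \<Delta>"
    by (simp add: z_def)
  have "inv\<^bsub>\<Delta>\<^esub> a \<otimes>\<^bsub>\<Delta>\<^esub> z \<otimes>\<^bsub>\<Delta>\<^esub> a \<in> normal_core \<Delta> (H m)"
  proof (rule M0, goal_cases)
    case 2
    show ?case
    proof
      fix e assume e: "e \<in> H q"
      have ec: "e \<in> carrier \<Delta>"
        using e B.G_subset by blast
      \<comment> \<open>Conjugating \<open>e\<close> by \<open>a\<close> gives an element
        stabilizing \<open>y q\<close>, hence one in the range of \<open>R\<close>, with a partner
        \<open>d\<close>.\<close>
      let ?e = "a \<otimes>\<^bsub>\<Delta>\<^esub> e \<otimes>\<^bsub>\<Delta>\<^esub> inv\<^bsub>\<Delta>\<^esub> a"
      have "inv\<^bsub>\<Delta>\<^esub> a \<otimes>\<^bsub>\<Delta>\<^esub> ?e \<otimes>\<^bsub>\<Delta>\<^esub> a = e"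
        using a ec by (simp add: B.m_assoc) (simp add: B.m_assoc [symmetric])
      then have "?e \<in> coset_stabilizer \<Delta> (y q)"
        using a ec e by (simp add: yq B.mem_coset_stabilizer_iff)
      then obtain d where d: "(d, ?e) \<in> R"
        using q by force
      have dc: "d \<in> carrier \<Gamma>"
        using R_carrier(1)[OF d] .
      have "inv\<^bsub>\<Gamma>\<^esub> d \<otimes>\<^bsub>\<Gamma>\<^esub> g [^]\<^bsub>\<Gamma>\<^esub> n \<otimes>\<^bsub>\<Gamma>\<^esub> d \<in> normal_core \<Gamma> (G l)"
        unfolding n_def
        by (rule A.normal_core_conj[OF A.subgroup_G A.power_level_order dc]) simp
      then have "inv\<^bsub>\<Gamma>\<^esub> d \<otimes>\<^bsub>\<Gamma>\<^esub> g [^]\<^bsub>\<Gamma>\<^esub> n \<otimes>\<^bsub>\<Gamma>\<^esub> d \<in> coset_stabilizer \<Gamma> (x l)"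
        using A.point_lcosets[OF x, of l]
        by (simp add: A.mem_normal_core_iff_fixes[OF A.subgroup_G] coset_stabilizer_def)
      moreover have "(inv\<^bsub>\<Gamma>\<^esub> d \<otimes>\<^bsub>\<Gamma>\<^esub> g [^]\<^bsub>\<Gamma>\<^esub> n \<otimes>\<^bsub>\<Gamma>\<^esub> d,
          inv\<^bsub>\<Delta>\<^esub> ?e \<otimes>\<^bsub>\<Delta>\<^esub> z \<otimes>\<^bsub>\<Delta>\<^esub> ?e) \<in> R"
        unfolding z_def by (intro R_mult R_inv R_pow gg d)
      ultimately have "inv\<^bsub>\<Delta>\<^esub> ?e \<otimes>\<^bsub>\<Delta>\<^esub> z \<otimes>\<^bsub>\<Delta>\<^esub> ?e \<in> coset_stabilizer \<Delta> (y M)"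
        using l(2) by blast
      then have "inv\<^bsub>\<Delta>\<^esub> a \<otimes>\<^bsub>\<Delta>\<^esub> (inv\<^bsub>\<Delta>\<^esub> ?e \<otimes>\<^bsub>\<Delta>\<^esub> z \<otimes>\<^bsub>\<Delta>\<^esub> ?e) \<otimes>\<^bsub>\<Delta>\<^esub> a \<in> H M"
        using a by (simp add: B.mem_coset_stabilizer_iff)
      also have "inv\<^bsub>\<Delta>\<^esub> a \<otimes>\<^bsub>\<Delta>\<^esub> (inv\<^bsub>\<Delta>\<^esub> ?e \<otimes>\<^bsub>\<Delta>\<^esub> z \<otimes>\<^bsub>\<Delta>\<^esub> ?e) \<otimes>\<^bsub>\<Delta>\<^esub> a =
          inv\<^bsub>\<Delta>\<^esub> e \<otimes>\<^bsub>\<Delta>\<^esub> (inv\<^bsub>\<Delta>\<^esub> a \<otimes>\<^bsub>\<Delta>\<^esub> z \<otimes>\<^bsub>\<Delta>\<^esub> a) \<otimes>\<^bsub>\<Delta>\<^esub> e"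
      proof -
        have c1: "inv\<^bsub>\<Delta>\<^esub> a \<otimes>\<^bsub>\<Delta>\<^esub> (a \<otimes>\<^bsub>\<Delta>\<^esub> w) = w" if "w \<in> carrier \<Delta>" for w
          using a that by (simp add: B.m_assoc [symmetric])
        show ?thesis
          using a ec z by (simp add: B.inv_mult_group B.m_assoc c1)
      qed
      finally show "inv\<^bsub>\<Delta>\<^esub> e \<otimes>\<^bsub>\<Delta>\<^esub> (inv\<^bsub>\<Delta>\<^esub> a \<otimes>\<^bsub>\<Delta>\<^esub> z \<otimes>\<^bsub>\<Delta>\<^esub> a) \<otimes>\<^bsub>\<Delta>\<^esub> e \<in> H M0"
        using HM by blast
    qed
  qed (use a z in simp)
  then have "z \<in> normal_core \<Delta> (H m)"
    using B.normal_core_conj_iff[OF B.subgroup_G z a(1)] by blast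
  then have "level_order \<Delta> H m g' dvd n"
    unfolding z_def by (simp add: B.level_order(2))
  then show ?thesis
    using l(1) unfolding n_def by (intro exI[of _ l]) simp
qed

lemma element_type_eq:
  assumes "locally_determined_core \<Gamma> G p" "coset_stabilizer \<Gamma> (x p) \<subseteq> fst ` R"
    and "locally_determined_core \<Delta> H q" "coset_stabilizer \<Delta> (y q) \<subseteq> snd ` R"
    and gg: "(g, g') \<in> R"
  shows "element_type \<Gamma> G g = element_type \<Delta> H g'"
proof -
  interpret rev: chain_correspondence \<Delta> H \<Gamma> G y x "R\<inverse>"
    by (rule converse)
  have R': "snd ` R\<inverse> = fst ` R"
    by force
  have "\<exists>m>0. level_order \<Gamma> G l g dvd level_order \<Delta> H m g'" for l
    using rev.level_order_cofinal[of p g' g l] assms R' by simp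
  moreover have "\<exists>l>0. level_order \<Delta> H m g' dvd level_order \<Gamma> G l g" for m
    using level_order_cofinal[of q g g' m] assms by simp
  ultimately show ?thesis
    unfolding A.element_type_eq B.element_type_eq
    using A.level_order(1)[OF R_carrier(1)[OF gg]] B.level_order(1)[OF R_carrier(2)[OF gg]]
    by (intro type_of_lcm_eqI[of 1 1]) (auto simp: Bex_def)
qed

text \<open>An element \<open>g\<close> may lie outside the domain of \<open>R\<close>, but some
  positive power lies in the core of \<open>G p\<close>, hence stabilizes \<open>x p\<close> and
  belongs to the domain. By \<open>element_type_power\<close> this power has the type of
  \<open>g\<close>.\<close>

lemma chain_typeset_subset:
  assumes "locally_determined_core \<Gamma> G p" "coset_stabilizer \<Gamma> (x p) \<subseteq> fst ` R"
    and "locally_determined_core \<Delta> H q" "coset_stabilizer \<Delta> (y q) \<subseteq> snd ` R"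
  shows "chain_typeset \<Gamma> G \<subseteq> chain_typeset \<Delta> H"
proof
  fix t assume "t \<in> chain_typeset \<Gamma> G"
  then obtain g where g: "g \<in> carrier \<Gamma>" "t = element_type \<Gamma> G g"
    unfolding chain_typeset_def by blast
  obtain n where n: "n \<ge> 1" "g [^]\<^bsub>\<Gamma>\<^esub> (n::nat) \<in> normal_core \<Gamma> (G p)"
    using A.level_order(1)[OF g(1)] A.power_level_order[OF g(1)] by blast
  have "g [^]\<^bsub>\<Gamma>\<^esub> n \<in> coset_stabilizer \<Gamma> (x p)"
    using n(2) A.point_lcosets[OF x, of p]
    by (simp add: A.mem_normal_core_iff_fixes[OF A.subgroup_G] coset_stabilizer_def)
  then obtain g' where g': "(g [^]\<^bsub>\<Gamma>\<^esub> n, g') \<in> R"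
    using assms(2) by force
  have "t = element_type \<Gamma> G (g [^]\<^bsub>\<Gamma>\<^esub> n)"
    using g n(1) by (simp add: A.element_type_power)
  also have "\<dots> = element_type \<Delta> H g'"
    by (rule element_type_eq[OF assms g'])
  finally show "t \<in> chain_typeset \<Delta> H"
    using R_carrier(2)[OF g'] unfolding chain_typeset_def by blast
qed

lemma chain_typeset_eq:
  assumes "locally_determined_core \<Gamma> G p" "coset_stabilizer \<Gamma> (x p) \<subseteq> fst ` R"
    and "locally_determined_core \<Delta> H q" "coset_stabilizer \<Delta> (y q) \<subseteq> snd ` R"
  shows "chain_typeset \<Gamma> G = chain_typeset \<Delta> H"
proof
  interpret rev: chain_correspondence \<Delta> H \<Gamma> G y x "R\<inverse>"
    by (rule converse)
  have "fst ` R\<inverse> = snd ` R" "snd ` R\<inverse> = fst ` R"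
    by force+
  then show "chain_typeset \<Delta> H \<subseteq> chain_typeset \<Gamma> G"
    using rev.chain_typeset_subset assms by metis
qed (rule chain_typeset_subset[OF assms])

end

section \<open>Renormalizations\<close>

locale renormalized_group = group \<Gamma> for \<Gamma> :: "('a, 'm) monoid_scheme" (structure) +
  fixes \<phi> :: "'a \<Rightarrow> 'a"
  assumes renormalization: "renormalization \<Gamma> \<phi>"
begin

section \<open>The images of the iterates form a strict group chain\<close>

abbreviation C :: "nat \<Rightarrow> 'a set" where
  "C \<equiv> renorm_chain \<Gamma> \<phi>"

lemma hom_\<phi>: "\<phi> \<in> hom \<Gamma> \<Gamma>"
  and inj_on_\<phi>: "inj_on \<phi> (carrier \<Gamma>)"
  using renormalization by (simp_all add: renormalization_def)

lemma group_hom_\<phi>: "group_hom \<Gamma> \<Gamma> \<phi>"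
  by (simp add: group_hom_def group_hom_axioms_def is_group hom_\<phi>)

lemma subgroup_C: "subgroup (C l) \<Gamma>"
proof (induction l)
  case (Suc l)
  then show ?case
    using group_hom.subgroup_img_is_subgroup[OF group_hom_\<phi>] by simp
qed (simp add: subgroup_self)

lemma C_subset: "C l \<subseteq> carrier \<Gamma>"
  using subgroup_C by (rule subgroup.subset)

lemma C_Suc_subset: "C (Suc l) \<subseteq> C l"
proof (induction l)
  case 0
  show ?case
    using hom_\<phi> by (auto simp: hom_def)
next
  case (Suc l)
  then show ?case
    using image_mono[of "C (Suc l)" "C l" \<phi>] by simp
qed

text \<open>Injectivity of \<phi> carries strictness of the first inclusion to all later ones; this
  rules out isolated points of the odometer.\<close>

lemma C_Suc_neq: "C (Suc l) \<noteq> C l"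
proof (induction l)
  case 0
  show ?case
    using renormalization by (simp add: renormalization_def)
next
  case (Suc l)
  then show ?case
    using inj_on_image_eq_iff[OF inj_on_\<phi> C_subset C_subset, of "Suc l" l] by simp
qed

text \<open>\<phi> carries the cosets of \<open>C l\<close> onto the cosets of
  \<open>C (Suc l)\<close> inside \<open>C 1\<close>. Finiteness then passes through the tower
  \<open>C (Suc l) \<subseteq> C 1 \<subseteq> carrier \<Gamma>\<close>, whose upper step is finite
  by hypothesis.\<close>

lemma finite_lcosets_C: "finite (lcosets (C l))"
proof (induction l)
  case 0
  have "lcosets (C 0) \<subseteq> Pow (carrier \<Gamma>)"
    using lcosets_subset_PowG[OF subgroup_C] .
  have "a <# carrier \<Gamma> = carrier \<Gamma>" if "a \<in> carrier \<Gamma>" for a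
    using that coset_join3[OF that subgroup_self] by simp
  then have "lcosets (C 0) \<subseteq> {carrier \<Gamma>}"
    by (auto simp: lcosets_image)
  then show ?case
    using finite_subset by blast
next
  case (Suc l)
  have "\<phi> a <# \<phi> ` C l = \<phi> ` (a <# C l)" if "a \<in> carrier \<Gamma>" for a
    using that C_subset[of l] hom_mult[OF hom_\<phi>, of a] by (force simp: l_coset_def)
  then have "(\<lambda>g. g <# \<phi> ` C l) ` \<phi> ` carrier \<Gamma> = (`) \<phi> ` (lcosets (C l))"
    by (simp add: lcosets_image image_image)
  then have "finite ((\<lambda>g. g <# C (Suc l)) ` C 1)"
    using Suc by simp
  moreover have "finite ((\<lambda>g. g <# C 1) ` carrier \<Gamma>)"
    using renormalization by (simp add: renormalization_def lcosets_image)
  moreover have "C (Suc l) \<subseteq> C 1"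
    using C_subset[of l] by auto
  ultimately show ?case
    unfolding lcosets_image
    using finite_lcosets_tower[OF subgroup_self subgroup_C subgroup_C C_subset] by blast
qed

sublocale coset_chain \<Gamma> C
proof
  show "group_chain \<Gamma> C"
    unfolding group_chain_def using is_group subgroup_C finite_lcosets_C C_Suc_subset by simp
qed

section \<open>Iterates of the embedding and pullback of cores\<close>

lemma iter_hom: "\<phi> ^^ n \<in> hom \<Gamma> \<Gamma>"
proof (induction n)
  case 0
  show ?case by (simp add: hom_def id_def)
next
  case (Suc n)
  then show ?case
    using hom_\<phi> by (auto simp: hom_def Pi_def)
qed

lemma iter_group_hom: "group_hom \<Gamma> \<Gamma> (\<phi> ^^ n)"
  by (simp add: group_hom_def group_hom_axioms_def is_group iter_hom)

lemma iter_closed: "g \<in> carrier \<Gamma> \<Longrightarrow> (\<phi> ^^ n) g \<in> carrier \<Gamma>"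
  by (rule hom_in_carrier[OF iter_hom])

lemma iter_inj: "inj_on (\<phi> ^^ n) (carrier \<Gamma>)"
proof (induction n)
  case (Suc n)
  have "(\<phi> ^^ n) ` carrier \<Gamma> \<subseteq> carrier \<Gamma>"
    using iter_closed by blast
  then have "inj_on \<phi> ((\<phi> ^^ n) ` carrier \<Gamma>)"
    by (rule inj_on_subset[OF inj_on_\<phi>])
  then show ?case
    unfolding funpow.simps by (rule comp_inj_on[OF Suc])
qed simp

lemma iter_image_C: "(\<phi> ^^ n) ` C l = C (n + l)"
proof (induction n)
  case (Suc n)
  have "(\<phi> ^^ Suc n) ` C l = \<phi> ` (\<phi> ^^ n) ` C l"
    by (simp add: image_image)
  then show ?case
    using Suc by simp
qed simp

lemma iter_conj:
  assumes "d \<in> carrier \<Gamma>" "w \<in> carrier \<Gamma>"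
  shows "inv ((\<phi> ^^ n) d) \<otimes> (\<phi> ^^ n) w \<otimes> (\<phi> ^^ n) d = (\<phi> ^^ n) (inv d \<otimes> w \<otimes> d)"
  using assms iter_closed
  by (simp add: group_hom.hom_inv[OF iter_group_hom] hom_mult[OF iter_hom])

lemma iter_conj_mem_C_iff:
  assumes "d \<in> carrier \<Gamma>" "w \<in> carrier \<Gamma>"
  shows "inv ((\<phi> ^^ n) d) \<otimes> (\<phi> ^^ n) w \<otimes> (\<phi> ^^ n) d \<in> C (n + l) \<longleftrightarrow> inv d \<otimes> w \<otimes> d \<in> C l"
  unfolding iter_conj[OF assms] iter_image_C [symmetric]
  using inj_on_image_mem_iff[OF iter_inj _ C_subset] assms by simp

text \<open>\<open>C n\<close> is the image of the whole group under \<open>\<phi> ^^ n\<close>, so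
  conjugation by elements of \<open>C n\<close> corresponds to conjugation of \<open>w\<close> by
  all of \<Gamma>. By injectivity, a condition local to \<open>C n\<close> pulls back to membership
  in a core.\<close>

lemma iter_preimage_normal_core:
  assumes "z \<in> C (n + l)" "\<And>e. e \<in> C n \<Longrightarrow> inv e \<otimes> z \<otimes> e \<in> C (n + l)"
  obtains w where "w \<in> normal_core \<Gamma> (C l)" "z = (\<phi> ^^ n) w"
proof -
  obtain w where w: "w \<in> C l" "z = (\<phi> ^^ n) w"
    using assms(1) unfolding iter_image_C [symmetric] by blast
  have wc: "w \<in> carrier \<Gamma>"
    using w C_subset by blast
  have "inv d \<otimes> w \<otimes> d \<in> C l" if d: "d \<in> carrier \<Gamma>" for d
  proof -
    have "(\<phi> ^^ n) d \<in> C n"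
      using iter_image_C[of n 0] d by auto
    from assms(2)[OF this] show ?thesis
      unfolding w(2) by (simp only: iter_conj_mem_C_iff[OF d wc])
  qed
  then show thesis
    using that w wc mem_normal_core_iff[OF subgroup_C] by blast
qed

text \<open>A core element satisfies the local condition for every conjugator; undoing
  \<open>n\<close> applications of \<phi> lowers the depth of the core by \<open>n\<close>.\<close>

lemma normal_core_shift:
  assumes "z \<in> normal_core \<Gamma> (C (n + l))"
  obtains w where "w \<in> normal_core \<Gamma> (C l)" "z = (\<phi> ^^ n) w"
proof (rule iter_preimage_normal_core)
  show "z \<in> C (n + l)"
    using assms normal_core_subset[OF subgroup_C] by blast
  show "inv e \<otimes> z \<otimes> e \<in> C (n + l)" if "e \<in> C n" for e
    using assms that C_subset mem_normal_core_iff[OF subgroup_C] by blast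
qed (rule that)

text \<open>The only use of finite generation: on each finite level, the actions twisted by the
  iterates of \<open>\<phi>\<close> are determined on a finite generating set, so two of them coincide.\<close>

lemma iterates_agree_on_level:
  obtains i j where "i < j"
    "\<And>g c. g \<in> carrier \<Gamma> \<Longrightarrow> c \<in> lcosets (C l) \<Longrightarrow> (\<phi> ^^ i) g <# c = (\<phi> ^^ j) g <# c"
proof -
  obtain S where S: "finite S" "S \<subseteq> carrier \<Gamma>" "generate \<Gamma> S = carrier \<Gamma>"
    using renormalization by (auto simp: renormalization_def finitely_generated_group_def)
  let ?L = "lcosets (C l)"
  let ?f = "\<lambda>i. \<lambda>s\<in>S. \<lambda>c\<in>?L. (\<phi> ^^ i) s <# c"
  have "finite (PiE S (\<lambda>_. PiE ?L (\<lambda>_. ?L)))"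
    using S finite_lcosets_C by (intro finite_PiE) auto
  moreover have "?f i \<in> PiE S (\<lambda>_. PiE ?L (\<lambda>_. ?L))" for i
    using S(2) iter_closed l_coset_lcosets[OF C_subset] by auto
  ultimately obtain i j where ij: "i < j" "?f i = ?f j"
    using finite_range_collision[of "PiE S (\<lambda>_. PiE ?L (\<lambda>_. ?L))" ?f] by blast
  \<comment> \<open>The arguments on which the two twisted actions agree form a subgroup; by the
    collision it contains the generators.\<close>
  define K where "K = {g \<in> carrier \<Gamma>. \<forall>c\<in>?L. (\<phi> ^^ i) g <# c = (\<phi> ^^ j) g <# c}"
  have sub: "c \<subseteq> carrier \<Gamma>" if "c \<in> ?L" for c
    using that subgroup.lcosets_carrier[OF subgroup_C is_group] by blast
  have "subgroup K \<Gamma>"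
  proof
    show "K \<subseteq> carrier \<Gamma>" by (auto simp: K_def)
    show "\<one> \<in> K"
      by (simp add: K_def group_hom.hom_one[OF iter_group_hom])
  next
    fix g h assume "g \<in> K" "h \<in> K"
    then have gh: "g \<in> carrier \<Gamma>" "h \<in> carrier \<Gamma>"
      and gK: "\<And>c. c \<in> ?L \<Longrightarrow> (\<phi> ^^ i) g <# c = (\<phi> ^^ j) g <# c"
      and hK: "\<And>c. c \<in> ?L \<Longrightarrow> (\<phi> ^^ i) h <# c = (\<phi> ^^ j) h <# c"
      by (auto simp: K_def)
    have mult: "(\<phi> ^^ n) (g \<otimes> h) <# c = (\<phi> ^^ n) g <# ((\<phi> ^^ n) h <# c)" if "c \<in> ?L" for n c
      using gh sub[OF that] iter_closed by (simp add: hom_mult[OF iter_hom] lcos_m_assoc)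
    have "(\<phi> ^^ i) (g \<otimes> h) <# c = (\<phi> ^^ j) (g \<otimes> h) <# c" if c: "c \<in> ?L" for c
    proof -
      have "(\<phi> ^^ j) h <# c \<in> ?L"
        using gh c iter_closed l_coset_lcosets[OF C_subset] by blast
      then show ?thesis
        by (simp only: mult[OF c] hK[OF c] gK)
    qed
    then show "g \<otimes> h \<in> K"
      using gh by (simp add: K_def)
  next
    fix g assume "g \<in> K"
    then have g: "g \<in> carrier \<Gamma>"
      and gK: "\<And>c. c \<in> ?L \<Longrightarrow> (\<phi> ^^ i) g <# c = (\<phi> ^^ j) g <# c"
      by (auto simp: K_def)
    have "(\<phi> ^^ i) (inv g) <# c = (\<phi> ^^ j) (inv g) <# c" if c: "c \<in> ?L" for c
    proof -
      have gi: "(\<phi> ^^ n) g \<in> carrier \<Gamma>" "(\<phi> ^^ n) (inv g) = inv ((\<phi> ^^ n) g)" for n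
        using g iter_closed group_hom.hom_inv[OF iter_group_hom] by auto
      have "(\<phi> ^^ i) (inv g) <# c \<in> ?L"
        using g c iter_closed l_coset_lcosets[OF C_subset] by simp
      from gK[OF this] have "(\<phi> ^^ j) g <# ((\<phi> ^^ i) (inv g) <# c) = c"
        using gi sub[OF c] by (simp add: lcos_m_assoc lcos_mult_one)
      moreover have "(\<phi> ^^ j) g <# ((\<phi> ^^ j) (inv g) <# c) = c"
        using gi sub[OF c] by (simp add: lcos_m_assoc lcos_mult_one)
      ultimately show ?thesis
        using l_coset_cancel[OF gi(1)[of j]] gi sub[OF c] l_coset_subset_G
        by (metis inv_closed)
    qed
    then show "inv g \<in> K"
      using g by (simp add: K_def)
  qed
  moreover have "S \<subseteq> K"
  proof
    fix s assume s: "s \<in> S"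
    have "(\<phi> ^^ i) s <# c = (\<phi> ^^ j) s <# c" if "c \<in> ?L" for c
      using fun_cong[OF fun_cong[OF ij(2), of s], of c] s that by simp
    then show "s \<in> K"
      using s S(2) by (auto simp: K_def)
  qed
  ultimately have "generate \<Gamma> S \<subseteq> K"
    using generate_subgroup_incl by blast
  then have "carrier \<Gamma> \<subseteq> K"
    using S(3) by simp
  then show thesis
    using that[OF ij(1)] by (auto simp: K_def)
qed

text \<open>Write \<open>x = \<phi>\<^sup>p x'\<close> and \<open>x' = \<phi>\<^sup>i x''\<close> with \<open>p = j - i - 1\<close>. Then \<open>\<phi> x = \<phi>\<^sup>j x''\<close> acts at level
  \<open>l\<close> as \<open>\<phi>\<^sup>i x'' = x'\<close>, that is, trivially.\<close>

lemma \<phi>_normal_core: "\<exists>m. \<forall>x\<in>normal_core \<Gamma> (C m). \<phi> x \<in> normal_core \<Gamma> (C l)"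
proof -
  obtain i j where ij: "i < j"
    "\<And>g c. g \<in> carrier \<Gamma> \<Longrightarrow> c \<in> lcosets (C l) \<Longrightarrow> (\<phi> ^^ i) g <# c = (\<phi> ^^ j) g <# c"
    using iterates_agree_on_level[of l] by blast
  define p where "p = j - i - 1"
  have j: "j = Suc p + i"
    using ij(1) by (simp add: p_def)
  have "\<phi> x \<in> normal_core \<Gamma> (C l)" if x: "x \<in> normal_core \<Gamma> (C (p + (i + l)))" for x
  proof -
    obtain x' where x': "x' \<in> normal_core \<Gamma> (C (i + l))" "x = (\<phi> ^^ p) x'"
      using x by (rule normal_core_shift)
    obtain x'' where x'': "x'' \<in> normal_core \<Gamma> (C l)" "x' = (\<phi> ^^ i) x''"
      using x'(1) by (rule normal_core_shift)
    have c'': "x'' \<in> carrier \<Gamma>"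
      using x''(1) mem_normal_core_iff[OF subgroup_C] by blast
    have \<phi>x: "\<phi> x = (\<phi> ^^ j) x''"
      by (simp add: x'(2) x''(2) j funpow_add)
    have "x' \<in> normal_core \<Gamma> (C l)"
      using x'(1) normal_core_antimono[of l "i + l"] by auto
    then have "(\<phi> ^^ j) x'' <# c = c" if "c \<in> lcosets (C l)" for c
      using ij(2)[OF c'' that] that by (simp add: x''(2) mem_normal_core_iff_fixes[OF subgroup_C])
    then show ?thesis
      using iter_closed[OF c''] by (simp add: \<phi>x mem_normal_core_iff_fixes[OF subgroup_C])
  qed
  then show ?thesis by blast
qed

text \<open>One application of \<phi> is controlled by passing to a deeper core. The induction
  varies the target level so that each further application can ask for the depth needed
  next.\<close>

lemma iter_normal_core: "\<exists>m. \<forall>x\<in>normal_core \<Gamma> (C m). (\<phi> ^^ q) x \<in> normal_core \<Gamma> (C l)"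
proof (induction q arbitrary: l)
  case 0
  show ?case by auto
next
  case (Suc q)
  obtain m where m: "\<forall>x\<in>normal_core \<Gamma> (C m). \<phi> x \<in> normal_core \<Gamma> (C l)"
    using \<phi>_normal_core by blast
  obtain m' where "\<forall>x\<in>normal_core \<Gamma> (C m'). (\<phi> ^^ q) x \<in> normal_core \<Gamma> (C m)"
    using Suc.IH by blast
  then show ?case
    using m by auto
qed

text \<open>An element acting trivially to depth \<open>q + m'\<close> on the cylinder of level
  \<open>q\<close> is the image under \<open>\<phi> ^^ q\<close> of an element of the core of
  \<open>C m'\<close>. For \<open>m'\<close> deep enough, \<open>iter_normal_core\<close> places
  this image in the core of \<open>C m\<close>.\<close>

lemma locally_determined_core_C: "locally_determined_core \<Gamma> C q"
  unfolding locally_determined_core_def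
proof
  fix m
  obtain m' where m': "\<forall>x\<in>normal_core \<Gamma> (C m'). (\<phi> ^^ q) x \<in> normal_core \<Gamma> (C m)"
    using iter_normal_core by blast
  have "z \<in> normal_core \<Gamma> (C m)"
    if z: "z \<in> carrier \<Gamma>" "\<forall>e\<in>C q. inv e \<otimes> z \<otimes> e \<in> C (q + m')" for z
  proof -
    have "inv \<one> \<otimes> z \<otimes> \<one> \<in> C (q + m')"
      using z(2) subgroup.one_closed[OF subgroup_C] by blast
    then have "z \<in> C (q + m')"
      using z(1) by simp
    then obtain w where "w \<in> normal_core \<Gamma> (C m')" "z = (\<phi> ^^ q) w"
      using iter_preimage_normal_core z(2) by blast
    then show ?thesis
      using m' by blast
  qed
  then show "\<exists>M. \<forall>z\<in>carrier \<Gamma>. (\<forall>e\<in>C q. inv e \<otimes> z \<otimes> e \<in> C M) \<longrightarrow> z \<in> normal_core \<Gamma> (C m)"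
    by blast
qed

end

section \<open>Correspondences from conjugacies and return equivalences\<close>

text \<open>Stabilizing \<open>x l\<close> means moving \<open>x\<close> within its cylinder of
  level \<open>l\<close>, so continuity of \<open>h\<close> at \<open>x\<close> becomes a statement
  on stabilizers. Equivariance is asked at \<open>x\<close> only, pair by pair, which suits
  relations and, with the roles exchanged, the inverse homeomorphism.\<close>

lemma continuous_stabilizer:
  assumes "coset_chain \<Gamma> G" "coset_chain \<Delta> H"
    and U: "openin (chain_space \<Gamma> G) U"
    and h: "continuous_map (subtopology (chain_space \<Gamma> G) U) (subtopology (chain_space \<Delta> H) V) h"
    and x: "x \<in> U"
  shows "\<exists>l. \<forall>g\<in>carrier \<Gamma>. \<forall>g'\<in>carrier \<Delta>.
    h (chain_action \<Gamma> G g x) = chain_action \<Delta> H g' (h x) \<longrightarrow>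
    g \<in> coset_stabilizer \<Gamma> (x l) \<longrightarrow> g' \<in> coset_stabilizer \<Delta> (h x m)"
proof -
  interpret A: coset_chain \<Gamma> G by fact
  interpret B: coset_chain \<Delta> H by fact
  have Usub: "U \<subseteq> A.points"
    using U by (rule openin_subset)
  have hU: "h z \<in> B.points" if "z \<in> U" for z
    using continuous_map_funspace[OF h] that Usub by (auto simp: Pi_iff)
  let ?W = "{z \<in> U. h z \<in> B.cylinder (h x) m}"
  have "continuous_map (subtopology (chain_space \<Gamma> G) U) (chain_space \<Delta> H) h"
    using h by (simp add: continuous_map_in_subtopology)
  from openin_continuous_map_preimage[OF this B.openin_cylinder[of "h x" m]]
  have "openin (subtopology (chain_space \<Gamma> G) U) ?W"
    by (simp only: topspace_subtopology_subset[OF Usub])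
  then have "openin (chain_space \<Gamma> G) ?W"
    using U openin_open_subtopology by blast
  moreover have "x \<in> ?W"
    using x hU B.cylinder_refl by blast
  ultimately obtain l where l: "A.cylinder x l \<subseteq> ?W"
    using A.cylinder_subset_open by blast
  have "g' \<in> coset_stabilizer \<Delta> (h x m)"
    if g: "g \<in> carrier \<Gamma>" "g' \<in> carrier \<Delta>"
      "h (chain_action \<Gamma> G g x) = chain_action \<Delta> H g' (h x)" "g \<in> coset_stabilizer \<Gamma> (x l)" for g g'
  proof -
    have xp: "x \<in> A.points"
      using x Usub by blast
    have "chain_action \<Gamma> G g x \<in> A.cylinder x l"
      using g xp by (simp add: A.cylinder_def A.chain_action_eq A.translate_in_points coset_stabilizer_def)
    then have "chain_action \<Delta> H g' (h x) \<in> B.cylinder (h x) m"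
      using l g(3) by auto
    then show ?thesis
      using g(2) hU[OF x] by (simp add: B.cylinder_def B.chain_action_eq coset_stabilizer_def)
  qed
  then show ?thesis by blast
qed

section \<open>Adapted sets and their return subgroups\<close>

context coset_chain
begin

lemma return_subgroup_iff:
  assumes "adapted_set \<Gamma> (chain_space \<Gamma> G) (chain_action \<Gamma> G) U"
  shows "g \<in> return_subgroup \<Gamma> (chain_action \<Gamma> G) U \<longleftrightarrow>
    g \<in> carrier \<Gamma> \<and> chain_action \<Gamma> G g ` U = U"
  using assms by (auto simp: return_subgroup_def adapted_set_def)

lemma chain_action_return:
  assumes "adapted_set \<Gamma> (chain_space \<Gamma> G) (chain_action \<Gamma> G) U"
    and "g \<in> return_subgroup \<Gamma> (chain_action \<Gamma> G) U" "z \<in> U"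
  shows "chain_action \<Gamma> G g z \<in> U" "chain_action \<Gamma> G (inv g) z \<in> U"
proof -
  have g: "g \<in> carrier \<Gamma>" "chain_action \<Gamma> G g ` U = U" and U: "U \<subseteq> points"
    using assms by (auto simp: return_subgroup_iff adapted_set_def dest: openin_subset)
  show "chain_action \<Gamma> G g z \<in> U"
    using g assms(3) by blast
  obtain w where "w \<in> U" "z = chain_action \<Gamma> G g w"
    using g assms(3) by blast
  then show "chain_action \<Gamma> G (inv g) z \<in> U"
    using g U chain_action_inv(2) by auto
qed

lemma return_subgroup_quotient:
  assumes U: "adapted_set \<Gamma> (chain_space \<Gamma> G) (chain_action \<Gamma> G) U"
    and g: "g \<in> return_subgroup \<Gamma> (chain_action \<Gamma> G) U" and k: "k \<in> return_subgroup \<Gamma> (chain_action \<Gamma> G) U"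
  shows "inv g \<otimes> k \<in> return_subgroup \<Gamma> (chain_action \<Gamma> G) U"
proof -
  obtain z where z: "z \<in> U" and Up: "U \<subseteq> points"
    using U by (auto simp: adapted_set_def dest: openin_subset)
  have gk: "g \<in> carrier \<Gamma>" "k \<in> carrier \<Gamma>"
    using g k by (auto simp: return_subgroup_def)
  have "chain_action \<Gamma> G (inv g \<otimes> k) z = chain_action \<Gamma> G (inv g) (chain_action \<Gamma> G k z)"
    using gk z Up by (intro chain_action_mult [symmetric]) auto
  also have "\<dots> \<in> U"
    by (intro chain_action_return[OF U] g k z)
  finally show ?thesis
    using gk z unfolding return_subgroup_def by blast
qed

text \<open>\<open>U\<close> contains a cylinder around \<open>x\<close>. An element stabilizing its
  level keeps \<open>x\<close> inside it, so the translate of \<open>U\<close> meets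
  \<open>U\<close>. This yields the conditions \<open>domain\<close> and
  \<open>range\<close>.\<close>

lemma coset_stabilizer_return:
  assumes U: "adapted_set \<Gamma> (chain_space \<Gamma> G) (chain_action \<Gamma> G) U" and x: "x \<in> U"
  shows "\<exists>q. coset_stabilizer \<Gamma> (x q) \<subseteq> return_subgroup \<Gamma> (chain_action \<Gamma> G) U"
proof -
  have Uo: "openin (chain_space \<Gamma> G) U"
    using U by (simp add: adapted_set_def)
  then have xp: "x \<in> points"
    using x openin_subset by blast
  obtain q where q: "cylinder x q \<subseteq> U"
    using cylinder_subset_open[OF Uo x] by blast
  have "g \<in> return_subgroup \<Gamma> (chain_action \<Gamma> G) U" if g: "g \<in> coset_stabilizer \<Gamma> (x q)" for g
  proof -
    have "chain_action \<Gamma> G g x \<in> cylinder x q"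
      using g xp by (simp add: cylinder_def chain_action_eq translate_in_points coset_stabilizer_def)
    then show ?thesis
      using q x g unfolding return_subgroup_def coset_stabilizer_def by blast
  qed
  then show ?thesis by blast
qed

end

lemma return_equivalent_correspondence:
  assumes "coset_chain \<Gamma> G" "coset_chain \<Delta> H"
    and "return_equivalent \<Gamma> (chain_space \<Gamma> G) (chain_action \<Gamma> G)
      \<Delta> (chain_space \<Delta> H) (chain_action \<Delta> H)"
  shows "\<exists>x y R. chain_correspondence \<Gamma> G \<Delta> H x y R"
proof -
  interpret A: coset_chain \<Gamma> G by fact
  interpret B: coset_chain \<Delta> H by fact
  let ?a = "chain_action \<Gamma> G" and ?b = "chain_action \<Delta> H"
  let ?X = "chain_space \<Gamma> G" and ?Y = "chain_space \<Delta> H"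
  obtain U V h k \<Theta> where U: "adapted_set \<Gamma> ?X ?a U" and V: "adapted_set \<Delta> ?Y ?b V"
    and hk: "homeomorphic_maps (subtopology ?X U) (subtopology ?Y V) h k"
    and \<Theta>: "\<Theta> \<in> iso (holonomy_group \<Gamma> ?X ?a U) (holonomy_group \<Delta> ?Y ?b V)"
    and conj: "\<And>f z. f \<in> carrier (holonomy_group \<Gamma> ?X ?a U) \<Longrightarrow>
      z \<in> topspace (subtopology ?X U) \<Longrightarrow> f z = k (\<Theta> f (h z))"
    using assms(3) unfolding return_equivalent_def isomorphic_actions_def by blast
  have Uo: "openin ?X U" and Vo: "openin ?Y V" and Up: "U \<subseteq> A.points" and Vp: "V \<subseteq> B.points"
    using U V by (auto simp: adapted_set_def dest: openin_subset)
  have top: "topspace (subtopology ?X U) = U" "topspace (subtopology ?Y V) = V"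
    by (rule topspace_subtopology_subset[OF Up], rule topspace_subtopology_subset[OF Vp])
  have hc: "continuous_map (subtopology ?X U) (subtopology ?Y V) h"
    and kc: "continuous_map (subtopology ?Y V) (subtopology ?X U) k"
    and kh: "\<And>z. z \<in> U \<Longrightarrow> k (h z) = z" and hk': "\<And>w. w \<in> V \<Longrightarrow> h (k w) = w"
    using hk unfolding homeomorphic_maps_def top by blast+
  have hU: "h z \<in> V" if "z \<in> U" for z
    using continuous_map_funspace[OF hc] that unfolding top by blast
  obtain x where x: "x \<in> U"
    using U by (auto simp: adapted_set_def)
  let ?RU = "return_subgroup \<Gamma> ?a U" and ?RV = "return_subgroup \<Delta> ?b V"
  \<comment> \<open>Pairs are related when \<open>h\<close> conjugates their effects on
    \<open>U\<close> and \<open>V\<close>. A relation is used because \<Theta> acts on induced maps,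
    each of which may come from many group elements.\<close>
  define R where "R = {(g, g'). g \<in> ?RU \<and> g' \<in> ?RV \<and> (\<forall>z\<in>U. h (?a g z) = ?b g' (h z))}"
  have RU: "?RU \<subseteq> carrier \<Gamma>" and RV: "?RV \<subseteq> carrier \<Delta>"
    by (auto simp: return_subgroup_def)
  have carrier_hol: "carrier (holonomy_group \<Gamma> ?X ?a U) = (\<lambda>g. restrict (?a g) U) ` ?RU"
    "carrier (holonomy_group \<Delta> ?Y ?b V) = (\<lambda>g. restrict (?b g) V) ` ?RV"
    by (simp_all add: holonomy_group_def)
  \<comment> \<open>Elements whose induced maps correspond under \<Theta> are related. As \<Theta>
    maps the first holonomy group onto the second, every element of either return subgroup then has
    a partner.\<close>
  have RI: "(g, g') \<in> R"
    if g: "g \<in> ?RU" "g' \<in> ?RV" and eq: "\<Theta> (restrict (?a g) U) = restrict (?b g') V" for g g'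
  proof -
    have "h (?a g z) = ?b g' (h z)" if z: "z \<in> U" for z
    proof -
      have "?a g z = k (?b g' (h z))"
        using conj[of "restrict (?a g) U" z] g(1) z subsetD[OF Up z] hU[OF z]
        by (simp add: carrier_hol top eq)
      moreover have "?b g' (h z) \<in> V"
        by (rule B.chain_action_return(1)[OF V g(2) hU[OF z]])
      ultimately show ?thesis
        by (simp add: hk')
    qed
    then show ?thesis
      using g by (simp add: R_def)
  qed
  have \<Theta>_image: "\<Theta> ` carrier (holonomy_group \<Gamma> ?X ?a U) = carrier (holonomy_group \<Delta> ?Y ?b V)"
    using \<Theta> by (simp add: iso_def bij_betw_def)
  have fst_R: "?RU \<subseteq> fst ` R"
  proof
    fix g assume g: "g \<in> ?RU"
    then have "\<Theta> (restrict (?a g) U) \<in> carrier (holonomy_group \<Delta> ?Y ?b V)"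
      using \<Theta>_image by (auto simp: carrier_hol)
    then obtain g' where "g' \<in> ?RV" "\<Theta> (restrict (?a g) U) = restrict (?b g') V"
      by (auto simp: carrier_hol)
    then show "g \<in> fst ` R"
      using RI[OF g] by force
  qed
  have snd_R: "?RV \<subseteq> snd ` R"
  proof
    fix g' assume g': "g' \<in> ?RV"
    then have "restrict (?b g') V \<in> \<Theta> ` carrier (holonomy_group \<Gamma> ?X ?a U)"
      unfolding \<Theta>_image by (simp add: carrier_hol)
    then obtain g where "g \<in> ?RU" "\<Theta> (restrict (?a g) U) = restrict (?b g') V"
      by (auto simp: carrier_hol)
    then show "g' \<in> snd ` R"
      using RI[OF _ g'] by force
  qed
  have "chain_correspondence \<Gamma> G \<Delta> H x (h x) R"
  proof
    show "x \<in> A.points" "h x \<in> B.points"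
      using x hU Up Vp by blast+
    show "R \<subseteq> carrier \<Gamma> \<times> carrier \<Delta>"
      using RU RV by (auto simp: R_def)
    show "\<exists>q. coset_stabilizer \<Gamma> (x q) \<subseteq> fst ` R"
      using A.coset_stabilizer_return[OF U x] fst_R by blast
    show "\<exists>q. coset_stabilizer \<Delta> (h x q) \<subseteq> snd ` R"
      using B.coset_stabilizer_return[OF V hU[OF x]] snd_R by blast
    show "\<exists>l. \<forall>g g'. (g, g') \<in> R \<longrightarrow>
        g \<in> coset_stabilizer \<Gamma> (x l) \<longrightarrow> g' \<in> coset_stabilizer \<Delta> (h x m)" for m
      using continuous_stabilizer[OF assms(1,2) Uo hc x, of m] RU RV x
      unfolding R_def by blast
    show "\<exists>m. \<forall>g g'. (g, g') \<in> R \<longrightarrow>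
        g' \<in> coset_stabilizer \<Delta> (h x m) \<longrightarrow> g \<in> coset_stabilizer \<Gamma> (x l)" for l
    proof -
      \<comment> \<open>On \<open>U\<close> the map \<open>k\<close> inverts \<open>h\<close>, which
        turns equivariance of \<open>h\<close> along \<open>R\<close> into that of \<open>k\<close>
        at \<open>h x\<close>.\<close>
      have k_eq: "k (?b g' (h x)) = ?a g (k (h x))" if "(g, g') \<in> R" for g g'
      proof -
        have "h (?a g x) = ?b g' (h x)" "g \<in> ?RU"
          using that x by (auto simp: R_def)
        then show ?thesis
          using kh[OF A.chain_action_return(1)[OF U _ x]] kh[OF x] by metis
      qed
      obtain m where "\<forall>g'\<in>carrier \<Delta>. \<forall>g\<in>carrier \<Gamma>. k (?b g' (h x)) = ?a g (k (h x)) \<longrightarrow>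
          g' \<in> coset_stabilizer \<Delta> (h x m) \<longrightarrow> g \<in> coset_stabilizer \<Gamma> (k (h x) l)"
        using continuous_stabilizer[OF assms(2,1) Vo kc hU[OF x], of l] by blast
      then have "\<forall>g g'. (g, g') \<in> R \<longrightarrow>
          g' \<in> coset_stabilizer \<Delta> (h x m) \<longrightarrow> g \<in> coset_stabilizer \<Gamma> (x l)"
        using k_eq RU RV unfolding kh[OF x] R_def by blast
      then show ?thesis ..
    qed
  next
    fix g g' c c' assume gg: "(g, g') \<in> R" and cc: "(c, c') \<in> R"
    then have mem: "g \<in> ?RU" "g' \<in> ?RV" "c \<in> ?RU" "c' \<in> ?RV"
      by (auto simp: R_def)
    then have carr: "g \<in> carrier \<Gamma>" "g' \<in> carrier \<Delta>" "c \<in> carrier \<Gamma>" "c' \<in> carrier \<Delta>"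
      using RU RV by auto
    have "h (?a (inv\<^bsub>\<Gamma>\<^esub> g \<otimes>\<^bsub>\<Gamma>\<^esub> c) z) = ?b (inv\<^bsub>\<Delta>\<^esub> g' \<otimes>\<^bsub>\<Delta>\<^esub> c') (h z)" if z: "z \<in> U" for z
    proof -
      \<comment> \<open>\<open>v\<close> solves the equation \<open>g v = c z\<close>. Applying
        \<open>h\<close> to both sides and cancelling \<open>g'\<close> determines
        \<open>h v\<close>.\<close>
      define v where "v = ?a (inv\<^bsub>\<Gamma>\<^esub> g \<otimes>\<^bsub>\<Gamma>\<^esub> c) z"
      have v: "v \<in> U"
        unfolding v_def
        by (rule A.chain_action_return(1)[OF U A.return_subgroup_quotient[OF U mem(1,3)] z])
      have "?a g v = ?a (g \<otimes>\<^bsub>\<Gamma>\<^esub> (inv\<^bsub>\<Gamma>\<^esub> g \<otimes>\<^bsub>\<Gamma>\<^esub> c)) z"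
        unfolding v_def using carr z Up by (intro A.chain_action_mult) auto
      also have "\<dots> = ?a c z"
        using carr by (simp add: A.m_assoc [symmetric])
      finally have "h (?a g v) = h (?a c z)"
        by (rule arg_cong)
      moreover have "h (?a g v) = ?b g' (h v)" "h (?a c z) = ?b c' (h z)"
        using gg cc v z by (simp_all add: R_def)
      ultimately have "?b g' (h v) = ?b c' (h z)"
        by (simp only:)
      then have "?b (inv\<^bsub>\<Delta>\<^esub> g') (?b g' (h v)) = ?b (inv\<^bsub>\<Delta>\<^esub> g') (?b c' (h z))"
        by simp
      moreover have "h v \<in> B.points" "h z \<in> B.points"
        using hU v z Vp by blast+
      ultimately show ?thesis
        using carr unfolding v_def [symmetric]
        by (simp add: B.chain_action_inv(2)) (simp add: B.chain_action_mult)
    qed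
    then show "(inv\<^bsub>\<Gamma>\<^esub> g \<otimes>\<^bsub>\<Gamma>\<^esub> c, inv\<^bsub>\<Delta>\<^esub> g' \<otimes>\<^bsub>\<Delta>\<^esub> c') \<in> R"
      using A.return_subgroup_quotient[OF U mem(1,3)] B.return_subgroup_quotient[OF V mem(2,4)]
      by (simp add: R_def)
  qed
  then show ?thesis by blast
qed

section \<open>Independence of the group chain model\<close>

context coset_chain
begin

lemma group_chain_model_self: "group_chain_model \<Gamma> (chain_space \<Gamma> G) (chain_action \<Gamma> G) G"
  unfolding group_chain_model_def using chain by (intro conjI exI[of _ id]) auto

text \<open>A conjugacy of \<Gamma>-actions relates every element to itself, so the diagonal is a
  correspondence with full domain and range. Level 0 can then be taken on both sides, where local
  determination of cores holds for every chain.\<close>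

lemma group_chain_model_type_typeset:
  assumes "group_chain_model \<Gamma> (chain_space \<Gamma> G) (chain_action \<Gamma> G) G'"
  shows "chain_type \<Gamma> G = chain_type \<Gamma> G'" and "chain_typeset \<Gamma> G = chain_typeset \<Gamma> G'"
proof -
  interpret B: coset_chain \<Gamma> G'
    by unfold_locales (use assms in \<open>simp add: group_chain_model_def\<close>)
  let ?X = "chain_space \<Gamma> G" and ?Y = "chain_space \<Gamma> G'"
  obtain h where "homeomorphic_map ?X ?Y h"
    and equiv: "\<And>g z. g \<in> carrier \<Gamma> \<Longrightarrow> z \<in> points \<Longrightarrow>
      h (chain_action \<Gamma> G g z) = chain_action \<Gamma> G' g (h z)"
    using assms by (auto simp: group_chain_model_def)
  then obtain k where hk: "homeomorphic_maps ?X ?Y h k"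
    by (auto simp: homeomorphic_map_maps)
  define x where "x = (\<lambda>l. \<one> <# G l)"
  have x: "x \<in> points"
    unfolding x_def by (rule base_orbit_in_points) simp
  have hx: "h x \<in> B.points" and kh: "\<And>z. z \<in> points \<Longrightarrow> k (h z) = z"
    using hk x continuous_map_funspace by (fastforce simp: homeomorphic_maps_def)+
  \<comment> \<open>The whole spaces are written as subtopologies of themselves to match
    \<open>continuous_stabilizer\<close>, which is stated for open subsets.\<close>
  have hc: "continuous_map (subtopology ?X points) (subtopology ?Y B.points) h"
    and kc: "continuous_map (subtopology ?Y B.points) (subtopology ?X points) k"
    using hk by (simp_all add: homeomorphic_maps_def)
  let ?R = "(\<lambda>g. (g, g)) ` carrier \<Gamma>"
  have R: "fst ` ?R = carrier \<Gamma>" "snd ` ?R = carrier \<Gamma>"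
    by (simp_all add: image_image)
  have stab: "coset_stabilizer \<Gamma> c \<subseteq> carrier \<Gamma>" for c
    by (auto simp: coset_stabilizer_def)
  interpret chain_correspondence \<Gamma> G \<Gamma> G' x "h x" ?R
  proof
    show "\<exists>l. \<forall>g g'. (g, g') \<in> ?R \<longrightarrow>
        g \<in> coset_stabilizer \<Gamma> (x l) \<longrightarrow> g' \<in> coset_stabilizer \<Gamma> (h x m)" for m
      using continuous_stabilizer[OF coset_chain_axioms B.coset_chain_axioms openin_topspace hc x, of m]
        equiv[OF _ x] by blast
    show "\<exists>m. \<forall>g g'. (g, g') \<in> ?R \<longrightarrow>
        g' \<in> coset_stabilizer \<Gamma> (h x m) \<longrightarrow> g \<in> coset_stabilizer \<Gamma> (x l)" for l
    proof -
      have "k (chain_action \<Gamma> G' g (h x)) = chain_action \<Gamma> G g x" if "g \<in> carrier \<Gamma>" for g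
        using equiv[OF that x] kh[OF chain_action_in_points[OF that x]] by simp
      then show ?thesis
        using continuous_stabilizer[OF B.coset_chain_axioms coset_chain_axioms openin_topspace kc hx, of l]
        unfolding kh[OF x] by blast
    qed
  qed (use x hx stab R in auto)
  show "chain_type \<Gamma> G = chain_type \<Gamma> G'"
    by (rule chain_type_eq)
  show "chain_typeset \<Gamma> G = chain_typeset \<Gamma> G'"
    by (rule chain_typeset_eq[OF locally_determined_core_0 _ B.locally_determined_core_0])
       (simp_all add: R stab)
qed

lemma well_defined_type_chain:
  "well_defined_type \<Gamma> (chain_space \<Gamma> G) (chain_action \<Gamma> G)"
  unfolding well_defined_type_def using group_chain_model_self group_chain_model_type_typeset(1) by metis

lemma well_defined_typeset_chain:
  "well_defined_typeset \<Gamma> (chain_space \<Gamma> G) (chain_action \<Gamma> G)"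
  unfolding well_defined_typeset_def using group_chain_model_self group_chain_model_type_typeset(2) by metis

lemma group_chain_model_some:
  "group_chain_model \<Gamma> (chain_space \<Gamma> G) (chain_action \<Gamma> G)
     (SOME G'. group_chain_model \<Gamma> (chain_space \<Gamma> G) (chain_action \<Gamma> G) G')"
  by (rule someI[where x = G]) (rule group_chain_model_self)

lemma odometer_type_chain:
  "odometer_type \<Gamma> (chain_space \<Gamma> G) (chain_action \<Gamma> G) = chain_type \<Gamma> G"
  unfolding odometer_type_def
  by (rule group_chain_model_type_typeset(1)[OF group_chain_model_some, symmetric])

lemma odometer_typeset_chain:
  "odometer_typeset \<Gamma> (chain_space \<Gamma> G) (chain_action \<Gamma> G) = chain_typeset \<Gamma> G"
  unfolding odometer_typeset_def
  by (rule group_chain_model_type_typeset(2)[OF group_chain_model_some, symmetric])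

end

theorem theorem1p10:
  fixes \<Gamma> :: "('a, 'm) monoid_scheme" and \<phi> :: "'a \<Rightarrow> 'a"
  assumes "renormalization \<Gamma> \<phi>"
  shows "odometer \<Gamma> (renorm_space \<Gamma> \<phi>) (renorm_action \<Gamma> \<phi>) \<and>
    well_defined_type \<Gamma> (renorm_space \<Gamma> \<phi>) (renorm_action \<Gamma> \<phi>) \<and>
    well_defined_typeset \<Gamma> (renorm_space \<Gamma> \<phi>) (renorm_action \<Gamma> \<phi>) \<and>
    (\<forall>(\<Gamma>' :: ('b, 'n) monoid_scheme) \<phi>'.
       renormalization \<Gamma>' \<phi>' \<longrightarrow>
       return_equivalent \<Gamma> (renorm_space \<Gamma> \<phi>) (renorm_action \<Gamma> \<phi>)
         \<Gamma>' (renorm_space \<Gamma>' \<phi>') (renorm_action \<Gamma>' \<phi>') \<longrightarrow>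
       odometer_type \<Gamma> (renorm_space \<Gamma> \<phi>) (renorm_action \<Gamma> \<phi>) =
         odometer_type \<Gamma>' (renorm_space \<Gamma>' \<phi>') (renorm_action \<Gamma>' \<phi>') \<and>
       odometer_typeset \<Gamma> (renorm_space \<Gamma> \<phi>) (renorm_action \<Gamma> \<phi>) =
         odometer_typeset \<Gamma>' (renorm_space \<Gamma>' \<phi>') (renorm_action \<Gamma>' \<phi>'))"
  unfolding renorm_space_def renorm_action_def
proof (intro conjI allI impI)
  interpret A: renormalized_group \<Gamma> \<phi>
    using assms by (simp add: renormalized_group_def renormalized_group_axioms_def
        renormalization_def finitely_generated_group_def)
  show "odometer \<Gamma> (chain_space \<Gamma> A.C) (chain_action \<Gamma> A.C)"
    by (rule A.odometer_chain[OF A.C_Suc_neq])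
  show "well_defined_type \<Gamma> (chain_space \<Gamma> A.C) (chain_action \<Gamma> A.C)"
    by (rule A.well_defined_type_chain)
  show "well_defined_typeset \<Gamma> (chain_space \<Gamma> A.C) (chain_action \<Gamma> A.C)"
    by (rule A.well_defined_typeset_chain)
  fix \<Gamma>' :: "('b, 'n) monoid_scheme" and \<phi>'
  assume "renormalization \<Gamma>' \<phi>'"
  then interpret B: renormalized_group \<Gamma>' \<phi>'
    by (simp add: renormalized_group_def renormalized_group_axioms_def
        renormalization_def finitely_generated_group_def)
  assume "return_equivalent \<Gamma> (chain_space \<Gamma> A.C) (chain_action \<Gamma> A.C)
    \<Gamma>' (chain_space \<Gamma>' B.C) (chain_action \<Gamma>' B.C)"
  then obtain x y R where "chain_correspondence \<Gamma> A.C \<Gamma>' B.C x y R"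
    using return_equivalent_correspondence[OF A.coset_chain_axioms B.coset_chain_axioms] by blast
  then interpret chain_correspondence \<Gamma> A.C \<Gamma>' B.C x y R .
  show "odometer_type \<Gamma> (chain_space \<Gamma> A.C) (chain_action \<Gamma> A.C) =
      odometer_type \<Gamma>' (chain_space \<Gamma>' B.C) (chain_action \<Gamma>' B.C)"
    by (simp add: A.odometer_type_chain B.odometer_type_chain chain_type_eq)
  \<comment> \<open>These levels depend on the adapted sets; they are admissible since
    \<open>locally_determined_core_C\<close> holds at every level.\<close>
  obtain p q where "coset_stabilizer \<Gamma> (x p) \<subseteq> fst ` R" "coset_stabilizer \<Gamma>' (y q) \<subseteq> snd ` R"
    using domain range by blast
  then show "odometer_typeset \<Gamma> (chain_space \<Gamma> A.C) (chain_action \<Gamma> A.C) =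
      odometer_typeset \<Gamma>' (chain_space \<Gamma>' B.C) (chain_action \<Gamma>' B.C)"
    unfolding A.odometer_typeset_chain B.odometer_typeset_chain
    using chain_typeset_eq[OF A.locally_determined_core_C _ B.locally_determined_core_C] by blast
qed

end
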